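(* Let $\mathcal{A}$ be a pointed protomodular category. Then the following conditions are equivalent: (SH) two effective equivalence relations on a common object of $\mathcal{A}$ commute (in the sense of Smith) as soon as their normalisations commute (in the sense of Huq); (SH') every reflexive graph $C=(C_1,C_0,d,c,e)$ in $\mathcal{A}$ for which the kernels of the domain morphism $d$ and of the codomain morphism $c$ commute (in the sense of Huq) is a groupoid.
   Context: A pointed category (one with a zero object) is (Bourn) protomodular when it is finitely complete and the Split Short Five Lemma holds: given split epimorphisms $f\colon A\to B$ with section $s$ and $f'\colon A'\to B'$ with section $s'$, with kernels $\ker f\colon K[f]\to A$ and $\ker f'\colon K[f']\to A'$, and morphisms $k\colon K[f]\to K[f']$, $a\colon A\to A'$, $b\colon B\to B'$ with $a\ker f=\ker f'\,k$, $bf=f'a$, $s'b=as$, if $k$ and $b$ are isomorphisms then so is $a$. A reflexive graph $C=(C_1,C_0,d,c,e)$ consists of morphisms $d,c\colon C_1\to C_0$ (domain and codomain) and $e\colon C_0\to C_1$ with $de=ce=1_{C_0}$. It "is a groupoid" when it is the underlying reflexive graph of an internal groupoid. Two morphisms $k\colon X\to A$ and $l\colon Y\to A$ commute in the sense of Huq when there is a (necessarily unique) morphism $\varphi\colon X\times Y\to A$ with $\varphi\langle 1_X,0\rangle=k$ and $\varphi\langle 0,1_Y\rangle=l$. An equivalence relation is effective when it is the kernel pair of some morphism. Let $(R,r_0,r_1,\Delta_R)$ and $(S,s_0,s_1,\Delta_S)$ be equivalence relations on an object $A$, where $r_0,r_1\colon R\to A$ and $s_0,s_1\colon S\to A$ are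 the projections and $\Delta_R\colon A\to R$, $\Delta_S\colon A\to S$ the reflexivity morphisms. Let $R\times_A S$ be the pullback of $r_1$ and $s_0$. The pair $(R,S)$ commutes in the sense of Smith when there is a (necessarily unique) morphism $\theta\colon R\times_A S\to A$ with $\theta\langle 1_R,\Delta_S r_1\rangle=r_0$ and $\theta\langle \Delta_R s_0,1_S\rangle=s_1$. The normalisation of $R$ is the morphism $r_1\ker r_0\colon K[r_0]\to A$, and the normalisation of $S$ is the morphism $s_1\ker s_0\colon K[s_0]\to A$. *)

theory Defs
  imports Main
begin

section \<open>Categories\<close>

text \<open>The composite \<open>g \<cdot> f\<close> is ``\<open>g\<close> after \<open>f\<close>''. All operations are only meaningful on the
  carriers \<^term>\<open>Obj\<close> and \<^term>\<open>Arr\<close>, and composition only on composable pairs.\<close>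

record ('o, 'm) category =
  Obj  :: "'o set"
  Arr  :: "'m set"
  Dom  :: "'m \<Rightarrow> 'o"
  Cod  :: "'m \<Rightarrow> 'o"
  Idn  :: "'o \<Rightarrow> 'm"  ("\<one>\<index>")
  Comp :: "'m \<Rightarrow> 'm \<Rightarrow> 'm"  (infixr "\<cdot>\<index>" 75)

definition hom :: "('o, 'm) category \<Rightarrow> 'o \<Rightarrow> 'o \<Rightarrow> 'm set" where
  "hom C X Y = {f \<in> Arr C. Dom C f = X \<and> Cod C f = Y}"

locale category =
  fixes C :: "('o, 'm) category" (structure)
  assumes dom_obj: "f \<in> Arr C \<Longrightarrow> Dom C f \<in> Obj C"
    and cod_obj: "f \<in> Arr C \<Longrightarrow> Cod C f \<in> Obj C"
    and id_hom: "X \<in> Obj C \<Longrightarrow> \<one> X \<in> hom C X X"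
    and comp_hom: "\<lbrakk>f \<in> hom C X Y; g \<in> hom C Y Z\<rbrakk> \<Longrightarrow> g \<cdot> f \<in> hom C X Z"
    and comp_id_left: "f \<in> hom C X Y \<Longrightarrow> \<one> Y \<cdot> f = f"
    and comp_id_right: "f \<in> hom C X Y \<Longrightarrow> f \<cdot> \<one> X = f"
    and comp_assoc: "\<lbrakk>f \<in> hom C W X; g \<in> hom C X Y; h \<in> hom C Y Z\<rbrakk>
      \<Longrightarrow> (h \<cdot> g) \<cdot> f = h \<cdot> (g \<cdot> f)"

definition isomorphism :: "('o, 'm) category \<Rightarrow> 'm \<Rightarrow> bool" where
  "isomorphism C f \<longleftrightarrow> f \<in> Arr C \<and>
     (\<exists>g \<in> hom C (Cod C f) (Dom C f).
        g \<cdot>\<^bsub>C\<^esub> f = \<one>\<^bsub>C\<^esub> (Dom C f) \<and> f \<cdot>\<^bsub>C\<^esub> g = \<one>\<^bsub>C\<^esub> (Cod C f))"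

section \<open>Finite limits\<close>

definition is_functor ::
  "('i, 'a) category \<Rightarrow> ('o, 'm) category \<Rightarrow> ('i \<Rightarrow> 'o) \<Rightarrow> ('a \<Rightarrow> 'm) \<Rightarrow> bool" where
  "is_functor J C Fo Fa \<longleftrightarrow>
     (\<forall>i \<in> Obj J. Fo i \<in> Obj C \<and> Fa (\<one>\<^bsub>J\<^esub> i) = \<one>\<^bsub>C\<^esub> (Fo i)) \<and>
     (\<forall>u \<in> Arr J. Fa u \<in> hom C (Fo (Dom J u)) (Fo (Cod J u))) \<and>
     (\<forall>u \<in> Arr J. \<forall>v \<in> Arr J. Cod J u = Dom J v \<longrightarrow> Fa (v \<cdot>\<^bsub>J\<^esub> u) = Fa v \<cdot>\<^bsub>C\<^esub> Fa u)"

definition is_cone ::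
  "('i, 'a) category \<Rightarrow> ('o, 'm) category \<Rightarrow> ('i \<Rightarrow> 'o) \<Rightarrow> ('a \<Rightarrow> 'm) \<Rightarrow> 'o \<Rightarrow> ('i \<Rightarrow> 'm) \<Rightarrow> bool" where
  "is_cone J C Fo Fa X \<mu> \<longleftrightarrow> X \<in> Obj C \<and>
     (\<forall>i \<in> Obj J. \<mu> i \<in> hom C X (Fo i)) \<and>
     (\<forall>u \<in> Arr J. Fa u \<cdot>\<^bsub>C\<^esub> \<mu> (Dom J u) = \<mu> (Cod J u))"

definition is_limit ::
  "('i, 'a) category \<Rightarrow> ('o, 'm) category \<Rightarrow> ('i \<Rightarrow> 'o) \<Rightarrow> ('a \<Rightarrow> 'm) \<Rightarrow> 'o \<Rightarrow> ('i \<Rightarrow> 'm) \<Rightarrow> bool" where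
  "is_limit J C Fo Fa L \<pi> \<longleftrightarrow> is_cone J C Fo Fa L \<pi> \<and>
     (\<forall>X \<mu>. is_cone J C Fo Fa X \<mu> \<longrightarrow>
        (\<exists>!h. h \<in> hom C X L \<and> (\<forall>i \<in> Obj J. \<pi> i \<cdot>\<^bsub>C\<^esub> h = \<mu> i)))"

text \<open>Every finite category is isomorphic to one whose objects and arrows are natural numbers, so
  letting the index category \<open>J\<close> range over such categories covers all finite diagrams.\<close>

definition finitely_complete :: "('o, 'm) category \<Rightarrow> bool" where
  "finitely_complete C \<longleftrightarrow>
     (\<forall>(J :: (nat, nat) category) Fo Fa.
        category J \<and> finite (Obj J) \<and> finite (Arr J) \<and> is_functor J C Fo Fa \<longrightarrow>
        (\<exists>L \<pi>. is_limit J C Fo Fa L \<pi>))"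

definition is_product ::
  "('o, 'm) category \<Rightarrow> 'o \<Rightarrow> 'o \<Rightarrow> 'o \<Rightarrow> 'm \<Rightarrow> 'm \<Rightarrow> bool" where
  "is_product C X Y P p q \<longleftrightarrow> P \<in> Obj C \<and> p \<in> hom C P X \<and> q \<in> hom C P Y \<and>
     (\<forall>Z f g. f \<in> hom C Z X \<and> g \<in> hom C Z Y \<longrightarrow>
        (\<exists>!h. h \<in> hom C Z P \<and> p \<cdot>\<^bsub>C\<^esub> h = f \<and> q \<cdot>\<^bsub>C\<^esub> h = g))"

definition is_pullback ::
  "('o, 'm) category \<Rightarrow> 'm \<Rightarrow> 'm \<Rightarrow> 'o \<Rightarrow> 'm \<Rightarrow> 'm \<Rightarrow> bool" where
  "is_pullback C f g P p q \<longleftrightarrow>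
     f \<in> Arr C \<and> g \<in> Arr C \<and> Cod C f = Cod C g \<and>
     P \<in> Obj C \<and> p \<in> hom C P (Dom C f) \<and> q \<in> hom C P (Dom C g) \<and> f \<cdot>\<^bsub>C\<^esub> p = g \<cdot>\<^bsub>C\<^esub> q \<and>
     (\<forall>Z x y. x \<in> hom C Z (Dom C f) \<and> y \<in> hom C Z (Dom C g) \<and> f \<cdot>\<^bsub>C\<^esub> x = g \<cdot>\<^bsub>C\<^esub> y \<longrightarrow>
        (\<exists>!h. h \<in> hom C Z P \<and> p \<cdot>\<^bsub>C\<^esub> h = x \<and> q \<cdot>\<^bsub>C\<^esub> h = y))"

text \<open>The morphism \<open>\<langle>x, y\<rangle>\<close> into a product or a pullback with projections \<open>p\<close> and \<open>q\<close>.\<close>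

definition induced :: "('o, 'm) category \<Rightarrow> 'm \<Rightarrow> 'm \<Rightarrow> 'm \<Rightarrow> 'm \<Rightarrow> 'm" where
  "induced C p q x y =
     (THE h. h \<in> hom C (Dom C x) (Dom C p) \<and> p \<cdot>\<^bsub>C\<^esub> h = x \<and> q \<cdot>\<^bsub>C\<^esub> h = y)"

section \<open>Pointed protomodular categories\<close>

definition zero_object :: "('o, 'm) category \<Rightarrow> 'o \<Rightarrow> bool" where
  "zero_object C Z \<longleftrightarrow> Z \<in> Obj C \<and>
     (\<forall>X \<in> Obj C. (\<exists>!f. f \<in> hom C X Z) \<and> (\<exists>!f. f \<in> hom C Z X))"

definition zero_mor :: "('o, 'm) category \<Rightarrow> 'o \<Rightarrow> 'o \<Rightarrow> 'm" where
  "zero_mor C X Y =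
     (THE z. \<exists>Z f g. zero_object C Z \<and> f \<in> hom C X Z \<and> g \<in> hom C Z Y \<and> z = g \<cdot>\<^bsub>C\<^esub> f)"

definition is_kernel :: "('o, 'm) category \<Rightarrow> 'm \<Rightarrow> 'm \<Rightarrow> bool" where
  "is_kernel C f k \<longleftrightarrow> f \<in> Arr C \<and> k \<in> Arr C \<and> Cod C k = Dom C f \<and>
     f \<cdot>\<^bsub>C\<^esub> k = zero_mor C (Dom C k) (Cod C f) \<and>
     (\<forall>Z. \<forall>x \<in> hom C Z (Dom C f). f \<cdot>\<^bsub>C\<^esub> x = zero_mor C Z (Cod C f) \<longrightarrow>
        (\<exists>!h. h \<in> hom C Z (Dom C k) \<and> k \<cdot>\<^bsub>C\<^esub> h = x))"

definition split_epi_with_section ::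
  "('o, 'm) category \<Rightarrow> 'o \<Rightarrow> 'o \<Rightarrow> 'm \<Rightarrow> 'm \<Rightarrow> bool" where
  "split_epi_with_section C A B f s \<longleftrightarrow>
     f \<in> hom C A B \<and> s \<in> hom C B A \<and> f \<cdot>\<^bsub>C\<^esub> s = \<one>\<^bsub>C\<^esub> B"

definition split_short_five_lemma :: "('o, 'm) category \<Rightarrow> bool" where
  "split_short_five_lemma C \<longleftrightarrow>
     (\<forall>A B f s A' B' f' s' kerf kerf' k a b.
        split_epi_with_section C A B f s \<and> split_epi_with_section C A' B' f' s' \<and>
        is_kernel C f kerf \<and> is_kernel C f' kerf' \<and>
        k \<in> hom C (Dom C kerf) (Dom C kerf') \<and> a \<in> hom C A A' \<and> b \<in> hom C B B' \<and>
        a \<cdot>\<^bsub>C\<^esub> kerf = kerf' \<cdot>\<^bsub>C\<^esub> k \<and> b \<cdot>\<^bsub>C\<^esub> f = f' \<cdot>\<^bsub>C\<^esub> a \<and> s' \<cdot>\<^bsub>C\<^esub> b = a \<cdot>\<^bsub>C\<^esub> s \<and>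
        isomorphism C k \<and> isomorphism C b \<longrightarrow> isomorphism C a)"

locale pointed_protomodular_category = category +
  assumes pointed: "\<exists>Z. zero_object C Z"
    and finitely_complete: "finitely_complete C"
    and split_short_five: "split_short_five_lemma C"

section \<open>Internal structures\<close>

definition reflexive_graph ::
  "('o, 'm) category \<Rightarrow> 'o \<Rightarrow> 'o \<Rightarrow> 'm \<Rightarrow> 'm \<Rightarrow> 'm \<Rightarrow> bool" where
  "reflexive_graph C C1 C0 d c e \<longleftrightarrow>
     C1 \<in> Obj C \<and> C0 \<in> Obj C \<and> d \<in> hom C C1 C0 \<and> c \<in> hom C C1 C0 \<and> e \<in> hom C C0 C1 \<and>
     d \<cdot>\<^bsub>C\<^esub> e = \<one>\<^bsub>C\<^esub> C0 \<and> c \<cdot>\<^bsub>C\<^esub> e = \<one>\<^bsub>C\<^esub> C0"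

text \<open>In terms of generalised elements, \<open>P\<close> consists of the pairs \<open>(x, y)\<close> with \<open>c x = d y\<close>, and
  \<open>m (x, y)\<close> is ``first \<open>x\<close>, then \<open>y\<close>''. The pullback \<open>T\<close> of \<open>q\<close> and \<open>p\<close>, with projections \<open>t\<close>
  and \<open>u\<close>, is the object of composable triples \<open>(x, y, z)\<close>, with \<open>t\<close> giving \<open>(x, y)\<close> and \<open>u\<close>
  giving \<open>(y, z)\<close>.\<close>

definition internal_category ::
  "('o, 'm) category \<Rightarrow> 'o \<Rightarrow> 'o \<Rightarrow> 'm \<Rightarrow> 'm \<Rightarrow> 'm \<Rightarrow> 'o \<Rightarrow> 'm \<Rightarrow> 'm \<Rightarrow> 'm \<Rightarrow> bool" where
  "internal_category C C1 C0 d c e P p q m \<longleftrightarrow>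
     reflexive_graph C C1 C0 d c e \<and> is_pullback C c d P p q \<and> m \<in> hom C P C1 \<and>
     d \<cdot>\<^bsub>C\<^esub> m = d \<cdot>\<^bsub>C\<^esub> p \<and> c \<cdot>\<^bsub>C\<^esub> m = c \<cdot>\<^bsub>C\<^esub> q \<and>
     m \<cdot>\<^bsub>C\<^esub> induced C p q (e \<cdot>\<^bsub>C\<^esub> d) (\<one>\<^bsub>C\<^esub> C1) = \<one>\<^bsub>C\<^esub> C1 \<and>
     m \<cdot>\<^bsub>C\<^esub> induced C p q (\<one>\<^bsub>C\<^esub> C1) (e \<cdot>\<^bsub>C\<^esub> c) = \<one>\<^bsub>C\<^esub> C1 \<and>
     (\<exists>T t u. is_pullback C q p T t u \<and>
        m \<cdot>\<^bsub>C\<^esub> induced C p q (m \<cdot>\<^bsub>C\<^esub> t) (q \<cdot>\<^bsub>C\<^esub> u) = m \<cdot>\<^bsub>C\<^esub> induced C p q (p \<cdot>\<^bsub>C\<^esub> t) (m \<cdot>\<^bsub>C\<^esub> u))"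

definition internal_groupoid ::
  "('o, 'm) category \<Rightarrow> 'o \<Rightarrow> 'o \<Rightarrow> 'm \<Rightarrow> 'm \<Rightarrow> 'm \<Rightarrow> 'o \<Rightarrow> 'm \<Rightarrow> 'm \<Rightarrow> 'm \<Rightarrow> 'm \<Rightarrow> bool" where
  "internal_groupoid C C1 C0 d c e P p q m i \<longleftrightarrow>
     internal_category C C1 C0 d c e P p q m \<and>
     i \<in> hom C C1 C1 \<and> d \<cdot>\<^bsub>C\<^esub> i = c \<and> c \<cdot>\<^bsub>C\<^esub> i = d \<and>
     m \<cdot>\<^bsub>C\<^esub> induced C p q (\<one>\<^bsub>C\<^esub> C1) i = e \<cdot>\<^bsub>C\<^esub> d \<and>
     m \<cdot>\<^bsub>C\<^esub> induced C p q i (\<one>\<^bsub>C\<^esub> C1) = e \<cdot>\<^bsub>C\<^esub> c"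

definition is_groupoid ::
  "('o, 'm) category \<Rightarrow> 'o \<Rightarrow> 'o \<Rightarrow> 'm \<Rightarrow> 'm \<Rightarrow> 'm \<Rightarrow> bool" where
  "is_groupoid C C1 C0 d c e \<longleftrightarrow> (\<exists>P p q m i. internal_groupoid C C1 C0 d c e P p q m i)"

text \<open>An internal relation is a jointly monic pair; symmetry and transitivity are witnessed by
  \<open>\<sigma>\<close> and \<open>\<tau>\<close>.\<close>

definition equivalence_relation ::
  "('o, 'm) category \<Rightarrow> 'o \<Rightarrow> 'o \<Rightarrow> 'm \<Rightarrow> 'm \<Rightarrow> 'm \<Rightarrow> bool" where
  "equivalence_relation C A R r0 r1 \<Delta> \<longleftrightarrow>
     A \<in> Obj C \<and> R \<in> Obj C \<and> r0 \<in> hom C R A \<and> r1 \<in> hom C R A \<and>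
     (\<forall>Z. \<forall>x \<in> hom C Z R. \<forall>y \<in> hom C Z R.
        r0 \<cdot>\<^bsub>C\<^esub> x = r0 \<cdot>\<^bsub>C\<^esub> y \<and> r1 \<cdot>\<^bsub>C\<^esub> x = r1 \<cdot>\<^bsub>C\<^esub> y \<longrightarrow> x = y) \<and>
     \<Delta> \<in> hom C A R \<and> r0 \<cdot>\<^bsub>C\<^esub> \<Delta> = \<one>\<^bsub>C\<^esub> A \<and> r1 \<cdot>\<^bsub>C\<^esub> \<Delta> = \<one>\<^bsub>C\<^esub> A \<and>
     (\<exists>\<sigma> \<in> hom C R R. r0 \<cdot>\<^bsub>C\<^esub> \<sigma> = r1 \<and> r1 \<cdot>\<^bsub>C\<^esub> \<sigma> = r0) \<and>
     (\<exists>P p q. is_pullback C r1 r0 P p q \<and>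
        (\<exists>\<tau> \<in> hom C P R. r0 \<cdot>\<^bsub>C\<^esub> \<tau> = r0 \<cdot>\<^bsub>C\<^esub> p \<and> r1 \<cdot>\<^bsub>C\<^esub> \<tau> = r1 \<cdot>\<^bsub>C\<^esub> q))"

definition effective_equivalence_relation ::
  "('o, 'm) category \<Rightarrow> 'o \<Rightarrow> 'o \<Rightarrow> 'm \<Rightarrow> 'm \<Rightarrow> 'm \<Rightarrow> bool" where
  "effective_equivalence_relation C A R r0 r1 \<Delta> \<longleftrightarrow>
     equivalence_relation C A R r0 r1 \<Delta> \<and>
     (\<exists>f. f \<in> Arr C \<and> Dom C f = A \<and> is_pullback C f f R r0 r1)"

section \<open>Commutation\<close>

text \<open>Products and pullbacks being unique up to isomorphism, it does not matter which one the
  connecting morphisms \<open>\<phi>\<close> and \<open>\<theta>\<close> are defined on.\<close>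

definition huq_commute :: "('o, 'm) category \<Rightarrow> 'm \<Rightarrow> 'm \<Rightarrow> bool" where
  "huq_commute C k l \<longleftrightarrow> k \<in> Arr C \<and> l \<in> Arr C \<and> Cod C k = Cod C l \<and>
     (let X = Dom C k; Y = Dom C l in
      \<exists>P p q \<phi>. is_product C X Y P p q \<and> \<phi> \<in> hom C P (Cod C k) \<and>
        \<phi> \<cdot>\<^bsub>C\<^esub> induced C p q (\<one>\<^bsub>C\<^esub> X) (zero_mor C X Y) = k \<and>
        \<phi> \<cdot>\<^bsub>C\<^esub> induced C p q (zero_mor C Y X) (\<one>\<^bsub>C\<^esub> Y) = l)"

definition smith_commute ::
  "('o, 'm) category \<Rightarrow> 'o \<Rightarrow> 'o \<Rightarrow> 'm \<Rightarrow> 'm \<Rightarrow> 'm \<Rightarrow> 'o \<Rightarrow> 'm \<Rightarrow> 'm \<Rightarrow> 'm \<Rightarrow> bool" where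
  "smith_commute C A R r0 r1 \<Delta>R S s0 s1 \<Delta>S \<longleftrightarrow>
     (\<exists>P p q \<theta>. is_pullback C r1 s0 P p q \<and> \<theta> \<in> hom C P A \<and>
        \<theta> \<cdot>\<^bsub>C\<^esub> induced C p q (\<one>\<^bsub>C\<^esub> R) (\<Delta>S \<cdot>\<^bsub>C\<^esub> r1) = r0 \<and>
        \<theta> \<cdot>\<^bsub>C\<^esub> induced C p q (\<Delta>R \<cdot>\<^bsub>C\<^esub> s0) (\<one>\<^bsub>C\<^esub> S) = s1)"

definition condition_SH :: "('o, 'm) category \<Rightarrow> bool" where
  "condition_SH C \<longleftrightarrow>
     (\<forall>A R r0 r1 \<Delta>R S s0 s1 \<Delta>S kerr0 kers0.
        effective_equivalence_relation C A R r0 r1 \<Delta>R \<and>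
        effective_equivalence_relation C A S s0 s1 \<Delta>S \<and>
        is_kernel C r0 kerr0 \<and> is_kernel C s0 kers0 \<and>
        huq_commute C (r1 \<cdot>\<^bsub>C\<^esub> kerr0) (s1 \<cdot>\<^bsub>C\<^esub> kers0) \<longrightarrow>
        smith_commute C A R r0 r1 \<Delta>R S s0 s1 \<Delta>S)"

definition condition_SH' :: "('o, 'm) category \<Rightarrow> bool" where
  "condition_SH' C \<longleftrightarrow>
     (\<forall>C1 C0 d c e kerd kerc.
        reflexive_graph C C1 C0 d c e \<and> is_kernel C d kerd \<and> is_kernel C c kerc \<and>
        huq_commute C kerd kerc \<longrightarrow>
        is_groupoid C C1 C0 d c e)"

end

theory Submission
  imports Defs
begin

text \<open>The proof computes with generalised elements, that is, with arbitrary arrows into the objects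
  at hand. Protomodularity enters through one fact, \<open>pullback_sections_jointly_epic\<close>: if \<open>c\<close> and
  \<open>d\<close> are split epimorphisms with sections \<open>s\<close> and \<open>t\<close>, then the two sections
  \<open>x \<mapsto> (x, t c x)\<close> and \<open>y \<mapsto> (s d y, y)\<close> into the pullback of \<open>c\<close> and \<open>d\<close> are jointly epic.
  Hence an operation \<open>F (x, y)\<close>, defined and natural for \<open>c x = d y\<close>, is determined by its values
  \<open>F (x, t c x)\<close> and \<open>F (s d y, y)\<close> (\<open>fibred_operation_eqI\<close>). The connecting morphism of a Huq
  commuting pair, that of a Smith commuting pair and the composition of an internal groupoid are
  operations of this kind whose two partial values are prescribed by unit laws; so every further
  law that they satisfy is proved by evaluating it on units.

  Suppose that \<open>SH\<close> holds and that the kernels of \<open>d\<close> and \<open>c\<close> commute for a reflexive graph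
  \<open>(d, c, e)\<close>. These kernels are the normalisations of the kernel pairs of \<open>d\<close> and \<open>c\<close>, so there
  is a connector \<open>\<theta> (x, y, z)\<close>, defined when \<open>d x = d y\<close> and \<open>c y = c z\<close>, with
  \<open>\<theta> (x, y, y) = x\<close> and \<open>\<theta> (y, y, z) = z\<close>. It behaves like \<open>x y\<^sup>-\<^sup>1 z\<close>, so that
  ``first \<open>x\<close>, then \<open>y\<close>'' is \<open>\<theta> (y, e d y, x)\<close> and the inverse of \<open>x\<close> is
  \<open>\<theta> (e d x, x, e c x)\<close> (\<open>groupoid_of_connector\<close>).

  Conversely, suppose that \<open>SH'\<close> holds, let \<open>R\<close> and \<open>S\<close> be the kernel pairs of \<open>f\<close> and \<open>g\<close>, and
  let \<open>\<phi>\<close> witness that the normalisations commute; these are kernels of \<open>f\<close> and \<open>g\<close>. Regard a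
  triple \<open>(x, y, z)\<close> with \<open>x R y S z\<close> as an arrow from \<open>x\<close> to \<open>z\<close>. The kernel of its domain consists
  of the triples \<open>(0, y, z)\<close>, where \<open>f y = 0\<close>, that of its codomain of the triples \<open>(x, y, 0)\<close>,
  where \<open>g y = 0\<close>, and these kernels commute by
  \<open>((0, y, z), (x, y', 0)) \<mapsto> (x, \<phi> (y, y'), z)\<close>. So the triples form a groupoid. The inverse of
  \<open>(x, y, z)\<close> has the form \<open>(z, w, x)\<close>, and \<open>w\<close>, the candidate for \<open>x y\<^sup>-\<^sup>1 z\<close>, is the connector.
  It satisfies the unit laws because the triples \<open>(x, y, y)\<close> form a copy of \<open>R\<close> and the triples
  \<open>(y, y, z)\<close> a copy of \<open>S\<close>, on which inversion can only be the symmetry of the relation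
  (\<open>inverse_of_kernel_pair_morphism\<close>).\<close>

section \<open>Composition\<close>

text \<open>Typing is kept as membership in \<^term>\<open>Arr\<close> plus separate equations for \<^term>\<open>Dom\<close> and
  \<^term>\<open>Cod\<close>, which rewriting can use to discharge the side conditions of associativity.\<close>

context category
begin

lemma mem_hom_iff: "f \<in> hom C X Y \<longleftrightarrow> f \<in> Arr C \<and> Dom C f = X \<and> Cod C f = Y"
  by (auto simp: hom_def)

lemma dom_in_obj [simp]: "f \<in> Arr C \<Longrightarrow> Dom C f \<in> Obj C"
  by (rule dom_obj)

lemma cod_in_obj [simp]: "f \<in> Arr C \<Longrightarrow> Cod C f \<in> Obj C"
  by (rule cod_obj)

lemma id_typing [simp]:
  assumes "X \<in> Obj C"
  shows "\<one> X \<in> Arr C" "Dom C (\<one> X) = X" "Cod C (\<one> X) = X"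
  using id_hom[OF assms] by (auto simp: mem_hom_iff)

lemma comp_typing [simp]:
  assumes "f \<in> Arr C" "g \<in> Arr C" "Cod C f = Dom C g"
  shows "g \<cdot> f \<in> Arr C" "Dom C (g \<cdot> f) = Dom C f" "Cod C (g \<cdot> f) = Cod C g"
  using comp_hom[of f "Dom C f" "Cod C f" g "Cod C g"] assms by (auto simp: mem_hom_iff)

lemma id_comp [simp]:
  assumes "f \<in> Arr C" "Cod C f = X"
  shows "\<one> X \<cdot> f = f"
  using comp_id_left[of f "Dom C f" X] assms by (auto simp: mem_hom_iff)

lemma comp_id [simp]:
  assumes "f \<in> Arr C" "Dom C f = X"
  shows "f \<cdot> \<one> X = f"
  using comp_id_right[of f X "Cod C f"] assms by (auto simp: mem_hom_iff)

lemma assoc [simp]: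
  assumes "f \<in> Arr C" "g \<in> Arr C" "h \<in> Arr C" "Cod C f = Dom C g" "Cod C g = Dom C h"
  shows "(h \<cdot> g) \<cdot> f = h \<cdot> (g \<cdot> f)"
  using comp_assoc[of f "Dom C f" "Cod C f" g "Cod C g" h "Cod C h"] assms
  by (auto simp: mem_hom_iff)

text \<open>Composites are normalised by nesting to the right. An equation between composites then no
  longer matches inside a longer composite, and this lemma gives the form that does.\<close>

lemma comp_eq_extend:
  assumes "g \<cdot> f = h" "f \<in> Arr C" "g \<in> Arr C" "Cod C f = Dom C g"
    and "w \<in> Arr C" "Cod C w = Dom C f"
  shows "g \<cdot> (f \<cdot> w) = h \<cdot> w"
  using assms assoc[of w f g] by auto

lemma isomorphism_id: "X \<in> Obj C \<Longrightarrow> isomorphism C (\<one> X)"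
  unfolding isomorphism_def mem_hom_iff by (auto intro!: bexI[of _ "\<one> X"] simp: mem_hom_iff)

section \<open>Pullbacks\<close>

lemma pullback_cospan:
  assumes "is_pullback C f g P p q"
  shows "f \<in> Arr C" "g \<in> Arr C" "Cod C f = Cod C g"
  using assms unfolding is_pullback_def by blast+

lemma pullback_typing:
  assumes "is_pullback C f g P p q"
  shows "P \<in> Obj C" "p \<in> Arr C" "Dom C p = P" "Cod C p = Dom C f"
    "q \<in> Arr C" "Dom C q = P" "Cod C q = Dom C g"
  using assms unfolding is_pullback_def mem_hom_iff by blast+

lemma pullback_square:
  assumes "is_pullback C f g P p q"
  shows "f \<cdot> p = g \<cdot> q"
  using assms unfolding is_pullback_def by blast

lemma pullback_universal:
  assumes "is_pullback C f g P p q"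
    and "x \<in> Arr C" "Cod C x = Dom C f" "y \<in> Arr C" "Cod C y = Dom C g" "Dom C x = Dom C y"
    and "f \<cdot> x = g \<cdot> y"
  shows "\<exists>!h. h \<in> hom C (Dom C x) P \<and> p \<cdot> h = x \<and> q \<cdot> h = y"
proof -
  have "x \<in> hom C (Dom C x) (Dom C f) \<and> y \<in> hom C (Dom C x) (Dom C g) \<and> f \<cdot> x = g \<cdot> y"
    using assms(2-) by (simp add: mem_hom_iff)
  then show ?thesis using assms(1) unfolding is_pullback_def by blast
qed

lemma pullback_eqI:
  assumes pb: "is_pullback C f g P p q"
    and h: "h \<in> Arr C" "Cod C h = P" "h' \<in> Arr C" "Cod C h' = P" "Dom C h = Dom C h'"
    and eq: "p \<cdot> h = p \<cdot> h'" "q \<cdot> h = q \<cdot> h'"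
  shows "h = h'"
proof -
  note [simp] = pullback_cospan[OF pb] pullback_typing[OF pb]
  have "f \<cdot> (p \<cdot> h) = g \<cdot> (q \<cdot> h)"
    using comp_eq_extend[OF pullback_square[OF pb], of h] h by simp
  then have "\<exists>!k. k \<in> hom C (Dom C h) P \<and> p \<cdot> k = p \<cdot> h \<and> q \<cdot> k = q \<cdot> h"
    using pullback_universal[OF pb, of "p \<cdot> h" "q \<cdot> h"] h by simp
  then show ?thesis using h eq by (metis mem_hom_iff)
qed

lemma induced_props:
  assumes pb: "is_pullback C f g P p q"
    and "x \<in> Arr C" "Cod C x = Dom C f" "y \<in> Arr C" "Cod C y = Dom C g" "Dom C x = Dom C y"
    and "f \<cdot> x = g \<cdot> y"
  shows "induced C p q x y \<in> Arr C" "Dom C (induced C p q x y) = Dom C y"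
    "Cod C (induced C p q x y) = P"
    "p \<cdot> induced C p q x y = x" "q \<cdot> induced C p q x y = y"
proof -
  from theI'[OF pullback_universal[OF assms]] pullback_typing[OF pb] assms(6)
  show "induced C p q x y \<in> Arr C" "Dom C (induced C p q x y) = Dom C y"
    "Cod C (induced C p q x y) = P"
    "p \<cdot> induced C p q x y = x" "q \<cdot> induced C p q x y = y"
    unfolding induced_def mem_hom_iff by auto
qed

lemma induced_comp:
  assumes pb: "is_pullback C f g P p q"
    and "x \<in> Arr C" "Cod C x = Dom C f" "y \<in> Arr C" "Cod C y = Dom C g" "Dom C x = Dom C y"
    and "f \<cdot> x = g \<cdot> y" "w \<in> Arr C" "Cod C w = Dom C y"
  shows "induced C p q x y \<cdot> w = induced C p q (x \<cdot> w) (y \<cdot> w)"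
proof -
  note i = induced_props[OF pb assms(2-7)]
  note pbt = pullback_cospan[OF pb] pullback_typing[OF pb]
  have "f \<cdot> (x \<cdot> w) = g \<cdot> (y \<cdot> w)"
    using comp_eq_extend[OF assms(7), of w] assms(2-6,8,9) pbt by simp
  then have j: "induced C p q (x \<cdot> w) (y \<cdot> w) \<in> Arr C"
    "Dom C (induced C p q (x \<cdot> w) (y \<cdot> w)) = Dom C w"
    "Cod C (induced C p q (x \<cdot> w) (y \<cdot> w)) = P"
    "p \<cdot> induced C p q (x \<cdot> w) (y \<cdot> w) = x \<cdot> w"
    "q \<cdot> induced C p q (x \<cdot> w) (y \<cdot> w) = y \<cdot> w"
    using induced_props[OF pb, of "x \<cdot> w" "y \<cdot> w"] assms(2-6,8,9) by simp_all
  have "p \<cdot> (induced C p q x y \<cdot> w) = x \<cdot> w" "q \<cdot> (induced C p q x y \<cdot> w) = y \<cdot> w"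
    using assms(8,9) pbt i by (simp_all add: comp_eq_extend[OF i(4)] comp_eq_extend[OF i(5)])
  then show ?thesis
    using assms(8,9) i j by - (rule pullback_eqI[OF pb]; simp)
qed

lemma induced_eqI:
  assumes pb: "is_pullback C f g P p q"
    and "h \<in> Arr C" "Cod C h = P" "p \<cdot> h = x" "q \<cdot> h = y"
  shows "induced C p q x y = h"
proof -
  note [simp] = pullback_cospan[OF pb] pullback_typing[OF pb] pullback_square[OF pb] induced_props[OF pb]
  have "f \<cdot> (p \<cdot> h) = g \<cdot> (q \<cdot> h)"
    using comp_eq_extend[OF pullback_square[OF pb], of h] assms by simp
  then have "induced C p q (p \<cdot> h) (q \<cdot> h) = h"
    using assms(2,3) by - (rule pullback_eqI[OF pb]; simp)
  then show ?thesis by (simp only: assms(4,5))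
qed

end

text \<open>The shape of a cospan: objects \<open>0\<close>, \<open>1\<close>, \<open>2\<close>, each serving as its own identity, and the two
  arrows \<open>3: 0 \<rightarrow> 2\<close> and \<open>4: 1 \<rightarrow> 2\<close>.\<close>

definition cospan :: "(nat, nat) category" where
  "cospan = \<lparr>Obj = {0, 1, 2}, Arr = {0, 1, 2, 3, 4},
     Dom = (\<lambda>u. if u = 3 then 0 else if u = 4 then 1 else u),
     Cod = (\<lambda>u. if u = 3 \<or> u = 4 then 2 else u),
     Idn = (\<lambda>i. i), Comp = (\<lambda>v u. if v \<le> 2 then u else v)\<rparr>"

lemma category_cospan: "category cospan"
  by unfold_locales (auto simp: cospan_def hom_def split: if_splits)

lemma (in category) pullback_exists:
  assumes "finitely_complete C" and fg: "f \<in> Arr C" "g \<in> Arr C" "Cod C f = Cod C g"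
  shows "\<exists>P p q. is_pullback C f g P p q"
proof -
  define Fo where "Fo i = (if i = (0::nat) then Dom C f else if i = 1 then Dom C g else Cod C g)"
    for i
  define Fa where "Fa u = (if u = (3::nat) then f else if u = 4 then g else \<one> (Fo u))" for u
  have "is_functor cospan C Fo Fa"
    using fg unfolding is_functor_def cospan_def
    by (auto simp: Fo_def Fa_def mem_hom_iff split: if_splits)
  moreover have "finite (Obj cospan)" "finite (Arr cospan)" by (auto simp: cospan_def)
  ultimately obtain L \<pi> where lim: "is_limit cospan C Fo Fa L \<pi>"
    using assms(1) category_cospan unfolding finitely_complete_def by blast
  have cone_iff: "is_cone cospan C Fo Fa X \<mu> \<longleftrightarrow> X \<in> Obj C \<and> \<mu> 0 \<in> hom C X (Dom C f) \<and>
      \<mu> 1 \<in> hom C X (Dom C g) \<and> \<mu> 2 \<in> hom C X (Cod C g) \<and> f \<cdot> \<mu> 0 = \<mu> 2 \<and> g \<cdot> \<mu> 1 = \<mu> 2" for X \<mu>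
    using fg by (auto simp: is_cone_def cospan_def Fo_def Fa_def mem_hom_iff)
  have "is_cone cospan C Fo Fa L \<pi>" using lim by (simp add: is_limit_def)
  then have cone: "L \<in> Obj C" "\<pi> 0 \<in> hom C L (Dom C f)" "\<pi> 1 \<in> hom C L (Dom C g)"
    "f \<cdot> \<pi> 0 = g \<cdot> \<pi> 1" "\<pi> 2 = g \<cdot> \<pi> 1"
    by (auto simp: cone_iff)
  have "is_pullback C f g L (\<pi> 0) (\<pi> 1)"
    unfolding is_pullback_def
  proof (intro conjI allI impI)
    fix Z x y assume xy: "x \<in> hom C Z (Dom C f) \<and> y \<in> hom C Z (Dom C g) \<and> f \<cdot> x = g \<cdot> y"
    define \<mu> where "\<mu> i = (if i = (0::nat) then x else if i = 1 then y else g \<cdot> y)" for i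
    have "is_cone cospan C Fo Fa Z \<mu>"
      using xy fg unfolding cone_iff by (auto simp: \<mu>_def mem_hom_iff)
    then have ex1: "\<exists>!h. h \<in> hom C Z L \<and> (\<forall>i \<in> Obj cospan. \<pi> i \<cdot> h = \<mu> i)"
      using lim unfolding is_limit_def by blast
    have "(\<forall>i \<in> Obj cospan. \<pi> i \<cdot> h = \<mu> i) \<longleftrightarrow> \<pi> 0 \<cdot> h = x \<and> \<pi> 1 \<cdot> h = y"
      if "h \<in> hom C Z L" for h
      using that fg cone by (auto simp: cospan_def \<mu>_def mem_hom_iff)
    then show "\<exists>!h. h \<in> hom C Z L \<and> \<pi> 0 \<cdot> h = x \<and> \<pi> 1 \<cdot> h = y"
      using ex1 by (simp cong: conj_cong)
  qed (use fg cone in auto)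
  then show ?thesis by blast
qed

section \<open>Zero morphisms, kernels and equalisers\<close>

definition is_equaliser :: "('o, 'm) category \<Rightarrow> 'm \<Rightarrow> 'm \<Rightarrow> 'm \<Rightarrow> bool" where
  "is_equaliser C u v n \<longleftrightarrow> n \<in> Arr C \<and> Cod C n = Dom C u \<and> u \<cdot>\<^bsub>C\<^esub> n = v \<cdot>\<^bsub>C\<^esub> n \<and>
     (\<forall>x. x \<in> Arr C \<and> Cod C x = Dom C u \<and> u \<cdot>\<^bsub>C\<^esub> x = v \<cdot>\<^bsub>C\<^esub> x \<longrightarrow>
        (\<exists>h. h \<in> Arr C \<and> Dom C h = Dom C x \<and> Cod C h = Dom C n \<and> n \<cdot>\<^bsub>C\<^esub> h = x)) \<and>
     (\<forall>h h'. h \<in> Arr C \<and> h' \<in> Arr C \<and> Dom C h = Dom C h' \<and> Cod C h = Dom C n \<and>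
        Cod C h' = Dom C n \<and> n \<cdot>\<^bsub>C\<^esub> h = n \<cdot>\<^bsub>C\<^esub> h' \<longrightarrow> h = h')"

context pointed_protomodular_category
begin

lemma zero_objectD:
  assumes "zero_object C N" "X \<in> Obj C"
  shows "\<exists>!f. f \<in> hom C X N" "\<exists>!f. f \<in> hom C N X"
proof -
  have "\<forall>X \<in> Obj C. (\<exists>!f. f \<in> hom C X N) \<and> (\<exists>!f. f \<in> hom C N X)"
    using assms(1) unfolding zero_object_def by (rule conjunct2)
  from bspec[OF this assms(2)] show "\<exists>!f. f \<in> hom C X N" "\<exists>!f. f \<in> hom C N X"
    by (rule conjunct1, rule conjunct2)
qed

lemma zero_object_eqI:
  assumes "zero_object C N" "f \<in> Arr C" "g \<in> Arr C" "Dom C f = Dom C g" "Cod C f = N" "Cod C g = N"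
  shows "f = g"
proof -
  have "\<exists>!h. h \<in> hom C (Dom C f) N" using assms by (simp add: zero_objectD(1))
  moreover have "f \<in> hom C (Dom C f) N" "g \<in> hom C (Dom C f) N"
    using assms by (simp_all add: mem_hom_iff)
  ultimately show ?thesis by blast
qed

lemma zero_object_eqI':
  assumes "zero_object C N" "f \<in> Arr C" "g \<in> Arr C" "Cod C f = Cod C g" "Dom C f = N" "Dom C g = N"
  shows "f = g"
proof -
  have "\<exists>!h. h \<in> hom C N (Cod C f)" using assms by (simp add: zero_objectD(2))
  moreover have "f \<in> hom C N (Cod C f)" "g \<in> hom C N (Cod C f)"
    using assms by (simp_all add: mem_hom_iff)
  ultimately show ?thesis by blast
qed

lemma zero_mor_eq:
  assumes "zero_object C N" "f \<in> hom C X N" "g \<in> hom C N Y"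
  shows "zero_mor C X Y = g \<cdot> f"
  unfolding zero_mor_def
proof (rule the_equality)
  fix z assume "\<exists>Z f g. zero_object C Z \<and> f \<in> hom C X Z \<and> g \<in> hom C Z Y \<and> z = g \<cdot> f"
  then obtain M f' g' where M: "zero_object C M"
    and *: "f' \<in> hom C X M" "g' \<in> hom C M Y" "z = g' \<cdot> f'"
    by blast
  have "M \<in> Obj C" using M unfolding zero_object_def by (rule conjunct1)
  then obtain h where h: "h \<in> hom C N M" using zero_objectD(2)[OF assms(1)] by blast
  have "h \<cdot> f = f'"
    using * assms(2,3) h by - (rule zero_object_eqI[OF M]; simp add: mem_hom_iff)
  moreover have "g' \<cdot> h = g"
    using * assms(2,3) h by - (rule zero_object_eqI'[OF assms(1)]; simp add: mem_hom_iff)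
  ultimately show "z = g \<cdot> f"
    using comp_assoc[OF assms(2) h *(2)] by (simp only: *(3))
next
  show "\<exists>Z f' g'. zero_object C Z \<and> f' \<in> hom C X Z \<and> g' \<in> hom C Z Y \<and> g \<cdot> f = g' \<cdot> f'"
    using assms by blast
qed

lemma zero_mor_factor:
  assumes "X \<in> Obj C" "Y \<in> Obj C"
  obtains N f g where "zero_object C N" "f \<in> hom C X N" "g \<in> hom C N Y"
proof -
  obtain N where N: "zero_object C N" using pointed by blast
  obtain f where "f \<in> hom C X N" using zero_objectD(1)[OF N assms(1)] by blast
  moreover obtain g where "g \<in> hom C N Y" using zero_objectD(2)[OF N assms(2)] by blast
  ultimately show thesis using N that by blast
qed

lemma zero_mor_typing [simp]:
  assumes "X \<in> Obj C" "Y \<in> Obj C"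
  shows "zero_mor C X Y \<in> Arr C" "Dom C (zero_mor C X Y) = X" "Cod C (zero_mor C X Y) = Y"
proof -
  obtain N f g where "zero_object C N" and fg: "f \<in> hom C X N" "g \<in> hom C N Y"
    by (rule zero_mor_factor[OF assms])
  then have "zero_mor C X Y = g \<cdot> f" by (intro zero_mor_eq)
  then show "zero_mor C X Y \<in> Arr C" "Dom C (zero_mor C X Y) = X" "Cod C (zero_mor C X Y) = Y"
    using fg by (simp_all add: mem_hom_iff)
qed

lemma zero_mor_comp [simp]:
  assumes "f \<in> Arr C" "Cod C f = Y" "Z \<in> Obj C"
  shows "zero_mor C Y Z \<cdot> f = zero_mor C (Dom C f) Z"
proof -
  have "Y \<in> Obj C" using assms by auto
  then obtain N h g where hg: "zero_object C N" "h \<in> hom C Y N" "g \<in> hom C N Z"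
    using zero_mor_factor assms(3) by blast
  moreover from this have "h \<cdot> f \<in> hom C (Dom C f) N" using assms by (simp add: mem_hom_iff)
  ultimately have "zero_mor C Y Z = g \<cdot> h" "zero_mor C (Dom C f) Z = g \<cdot> (h \<cdot> f)"
    using zero_mor_eq by blast+
  then show ?thesis using assms hg by (simp add: mem_hom_iff)
qed

lemma comp_zero_mor [simp]:
  assumes "g \<in> Arr C" "Dom C g = Y" "X \<in> Obj C"
  shows "g \<cdot> zero_mor C X Y = zero_mor C X (Cod C g)"
proof -
  have "Y \<in> Obj C" using assms by auto
  then obtain N h k where hk: "zero_object C N" "h \<in> hom C X N" "k \<in> hom C N Y"
    using zero_mor_factor assms(3) by blast
  moreover from this have "g \<cdot> k \<in> hom C N (Cod C g)" using assms by (simp add: mem_hom_iff)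
  ultimately have "zero_mor C X Y = k \<cdot> h" "zero_mor C X (Cod C g) = (g \<cdot> k) \<cdot> h"
    using zero_mor_eq by blast+
  then show ?thesis using assms hk by (simp add: mem_hom_iff)
qed

lemma kernel_typing:
  assumes "is_kernel C f k"
  shows "f \<in> Arr C" "k \<in> Arr C" "Cod C k = Dom C f" "f \<cdot> k = zero_mor C (Dom C k) (Cod C f)"
  using assms unfolding is_kernel_def by blast+

lemma kernel_universal:
  assumes "is_kernel C f k" "x \<in> Arr C" "Cod C x = Dom C f" "f \<cdot> x = zero_mor C (Dom C x) (Cod C f)"
  shows "\<exists>!h. h \<in> hom C (Dom C x) (Dom C k) \<and> k \<cdot> h = x"
proof -
  have "\<forall>Z. \<forall>x \<in> hom C Z (Dom C f). f \<cdot> x = zero_mor C Z (Cod C f) \<longrightarrow>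
      (\<exists>!h. h \<in> hom C Z (Dom C k) \<and> k \<cdot> h = x)"
    using assms(1) unfolding is_kernel_def by (elim conjE)
  moreover have "x \<in> hom C (Dom C x) (Dom C f)" using assms(2,3) by (simp add: mem_hom_iff)
  ultimately show ?thesis using assms(4) by (elim allE[of _ "Dom C x"]) (drule (1) bspec, erule (1) mp)
qed

lemma kernel_lift:
  assumes "is_kernel C f k" "x \<in> Arr C" "Cod C x = Dom C f" "f \<cdot> x = zero_mor C (Dom C x) (Cod C f)"
  obtains h where "h \<in> Arr C" "Dom C h = Dom C x" "Cod C h = Dom C k" "k \<cdot> h = x"
  using ex1_implies_ex[OF kernel_universal[OF assms]] that unfolding mem_hom_iff by blast

lemma kernel_cancel:
  assumes ker: "is_kernel C f k" and h: "h \<in> Arr C" "h' \<in> Arr C" "Dom C h = Dom C h'"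
    "Cod C h = Dom C k" "Cod C h' = Dom C k" "k \<cdot> h = k \<cdot> h'"
  shows "h = h'"
proof -
  note [simp] = kernel_typing[OF ker]
  have "f \<cdot> (k \<cdot> h) = zero_mor C (Dom C h) (Cod C f)"
    using comp_eq_extend[OF kernel_typing(4)[OF ker], of h] h(1,4) by simp
  then have "\<exists>!j. j \<in> hom C (Dom C (k \<cdot> h)) (Dom C k) \<and> k \<cdot> j = k \<cdot> h"
    using kernel_universal[OF ker, of "k \<cdot> h"] h(1,4) by simp
  moreover have "h \<in> hom C (Dom C (k \<cdot> h)) (Dom C k)" "h' \<in> hom C (Dom C (k \<cdot> h)) (Dom C k)"
    using h(1-5) by (simp_all add: mem_hom_iff)
  ultimately show ?thesis using h(6) by metis
qed

lemma is_kernelI: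
  assumes "f \<in> Arr C" "k \<in> Arr C" "Cod C k = Dom C f" "f \<cdot> k = zero_mor C (Dom C k) (Cod C f)"
    and lift: "\<And>x. \<lbrakk>x \<in> Arr C; Cod C x = Dom C f; f \<cdot> x = zero_mor C (Dom C x) (Cod C f)\<rbrakk>
      \<Longrightarrow> \<exists>h. h \<in> Arr C \<and> Dom C h = Dom C x \<and> Cod C h = Dom C k \<and> k \<cdot> h = x"
    and cancel: "\<And>h h'. \<lbrakk>h \<in> Arr C; h' \<in> Arr C; Dom C h = Dom C h'; Cod C h = Dom C k;
      Cod C h' = Dom C k; k \<cdot> h = k \<cdot> h'\<rbrakk> \<Longrightarrow> h = h'"
  shows "is_kernel C f k"
  unfolding is_kernel_def
proof (intro conjI allI ballI impI)
  fix Z x assume x: "x \<in> hom C Z (Dom C f)" and z: "f \<cdot> x = zero_mor C Z (Cod C f)"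
  then obtain h where "h \<in> hom C Z (Dom C k) \<and> k \<cdot> h = x"
    using lift[of x] unfolding mem_hom_iff by blast
  moreover have "h = h'"
    if "h \<in> hom C Z (Dom C k) \<and> k \<cdot> h = x" "h' \<in> hom C Z (Dom C k) \<and> k \<cdot> h' = x" for h h'
    using that unfolding mem_hom_iff by - (rule cancel; simp)
  ultimately show "\<exists>!h. h \<in> hom C Z (Dom C k) \<and> k \<cdot> h = x" by blast
qed (fact assms)+

lemma kernel_exists:
  assumes "f \<in> Arr C"
  obtains k where "is_kernel C f k"
proof -
  obtain N where N: "zero_object C N" using pointed by blast
  then have [simp]: "N \<in> Obj C" unfolding zero_object_def by (rule conjunct1)
  have "\<exists>P p q. is_pullback C f (zero_mor C N (Cod C f)) P p q"
    using assms by (simp add: pullback_exists finitely_complete)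
  then obtain P p q where pb: "is_pullback C f (zero_mor C N (Cod C f)) P p q" by blast
  note [simp] = pullback_typing[OF pb]
  have "is_kernel C f p"
  proof (rule is_kernelI)
    fix x assume x: "x \<in> Arr C" "Cod C x = Dom C f" "f \<cdot> x = zero_mor C (Dom C x) (Cod C f)"
    then show "\<exists>h. h \<in> Arr C \<and> Dom C h = Dom C x \<and> Cod C h = Dom C p \<and> p \<cdot> h = x"
      using induced_props[OF pb, of x "zero_mor C (Dom C x) N"] assms
      by (intro exI[of _ "induced C p q x (zero_mor C (Dom C x) N)"]) simp
  next
    fix h h'
    assume h: "h \<in> Arr C" "h' \<in> Arr C" "Dom C h = Dom C h'" "Cod C h = Dom C p"
      "Cod C h' = Dom C p" "p \<cdot> h = p \<cdot> h'"
    then have "q \<cdot> h = q \<cdot> h'" using assms by - (rule zero_object_eqI[OF N]; auto)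
    then show "h = h'" using h by - (rule pullback_eqI[OF pb]; auto)
  qed (use assms pullback_square[OF pb] in auto)
  then show thesis by (rule that)
qed

lemma equaliser_typing:
  assumes "is_equaliser C u v n"
  shows "n \<in> Arr C" "Cod C n = Dom C u" "u \<cdot> n = v \<cdot> n"
  using assms unfolding is_equaliser_def by blast+

lemma equaliser_lift:
  assumes "is_equaliser C u v n" "x \<in> Arr C" "Cod C x = Dom C u" "u \<cdot> x = v \<cdot> x"
  obtains h where "h \<in> Arr C" "Dom C h = Dom C x" "Cod C h = Dom C n" "n \<cdot> h = x"
  using assms that unfolding is_equaliser_def by blast

lemma equaliser_cancel:
  assumes "is_equaliser C u v n" "h \<in> Arr C" "h' \<in> Arr C" "Dom C h = Dom C h'"
    "Cod C h = Dom C n" "Cod C h' = Dom C n" "n \<cdot> h = n \<cdot> h'"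
  shows "h = h'"
  using assms unfolding is_equaliser_def by blast

lemma equaliser_exists:
  assumes uv: "u \<in> Arr C" "v \<in> Arr C" "Dom C u = Dom C v" "Cod C u = Cod C v"
  shows "\<exists>n. is_equaliser C u v n"
proof -
  obtain N where N: "zero_object C N" using pointed by blast
  then have [simp]: "N \<in> Obj C" unfolding zero_object_def by (rule conjunct1)
  let ?W = "Cod C v"
  have "\<exists>Q a b. is_pullback C (zero_mor C ?W N) (zero_mor C ?W N) Q a b"
    using uv by (simp add: pullback_exists finitely_complete)
  then obtain Q a b where Q: "is_pullback C (zero_mor C ?W N) (zero_mor C ?W N) Q a b" by blast
  \<comment> \<open>The equaliser is the pullback of the diagonal of the product of two copies of the codomain.\<close>
  define \<delta> where "\<delta> = induced C a b (\<one> ?W) (\<one> ?W)"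
  define w where "w = induced C a b u v"
  have \<delta>: "\<delta> \<in> Arr C" "Dom C \<delta> = ?W" "Cod C \<delta> = Q" "a \<cdot> \<delta> = \<one> ?W" "b \<cdot> \<delta> = \<one> ?W"
    using induced_props[OF Q, of "\<one> ?W" "\<one> ?W"] uv by (auto simp: \<delta>_def)
  have w: "w \<in> Arr C" "Dom C w = Dom C v" "Cod C w = Q" "a \<cdot> w = u" "b \<cdot> w = v"
    using induced_props[OF Q, of u v] uv by (auto simp: w_def)
  have "\<exists>E n m. is_pullback C w \<delta> E n m"
    using w \<delta> by (simp add: pullback_exists finitely_complete)
  then obtain E n m where E: "is_pullback C w \<delta> E n m" by blast
  note [simp] = pullback_typing[OF Q] pullback_typing[OF E]
  note Qext = comp_eq_extend[OF w(4)] comp_eq_extend[OF w(5)]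
    comp_eq_extend[OF \<delta>(4)] comp_eq_extend[OF \<delta>(5)]
  have eqm: "u \<cdot> n = m" "v \<cdot> n = m"
    using arg_cong[OF pullback_square[OF E], of "\<lambda>z. a \<cdot> z"]
      arg_cong[OF pullback_square[OF E], of "\<lambda>z. b \<cdot> z"] uv w \<delta> Qext by auto
  have "is_equaliser C u v n"
    unfolding is_equaliser_def
  proof (intro conjI allI impI; (elim conjE)?)
    fix x assume x: "x \<in> Arr C" "Cod C x = Dom C u" "u \<cdot> x = v \<cdot> x"
    have "w \<cdot> x = \<delta> \<cdot> (v \<cdot> x)"
      using x w \<delta> uv Qext by - (rule pullback_eqI[OF Q]; auto)
    then show "\<exists>h. h \<in> Arr C \<and> Dom C h = Dom C x \<and> Cod C h = Dom C n \<and> n \<cdot> h = x"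
      using induced_props[OF E, of x "v \<cdot> x"] x w \<delta> uv
      by (intro exI[of _ "induced C n m x (v \<cdot> x)"]) auto
  next
    fix h h' assume h: "h \<in> Arr C" "h' \<in> Arr C" "Dom C h = Dom C h'" "Cod C h = Dom C n"
      "Cod C h' = Dom C n" "n \<cdot> h = n \<cdot> h'"
    have "m \<cdot> h = m \<cdot> h'"
      using h comp_eq_extend[OF eqm(1), of h] comp_eq_extend[OF eqm(1), of h'] uv w by auto
    then show "h = h'" using h by - (rule pullback_eqI[OF E]; auto)
  qed (use uv w eqm in auto)
  then show ?thesis by blast
qed

end

section \<open>Joint epicness of the sections into a pullback of split epimorphisms\<close>

context pointed_protomodular_category
begin

text \<open>The equaliser \<open>n\<close> of \<open>u\<close> and \<open>v\<close> contains both sections, \<open>l\<close> and \<open>r\<close>. So it is a morphism of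
  split epimorphisms over \<open>Dom c\<close>, from \<open>p n\<close> to \<open>p\<close>. It is an isomorphism on their kernels, since the
  kernel of \<open>p\<close> is \<open>r\<close> restricted to the kernel of \<open>d\<close>, and this restriction factors through \<open>n\<close>. By the Split
  Short Five Lemma \<open>n\<close> is an isomorphism.\<close>

lemma pullback_sections_jointly_epic:
  assumes pb: "is_pullback C c d P p q"
    and s: "s \<in> Arr C" "Dom C s = Cod C d" "Cod C s = Dom C c" "c \<cdot> s = \<one> (Cod C d)"
    and t: "t \<in> Arr C" "Dom C t = Cod C d" "Cod C t = Dom C d" "d \<cdot> t = \<one> (Cod C d)"
    and uv: "u \<in> Arr C" "v \<in> Arr C" "Dom C u = P" "Dom C v = P" "Cod C u = Cod C v"
    and eq_l: "u \<cdot> induced C p q (\<one> (Dom C c)) (t \<cdot> c) = v \<cdot> induced C p q (\<one> (Dom C c)) (t \<cdot> c)"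
    and eq_r: "u \<cdot> induced C p q (s \<cdot> d) (\<one> (Dom C d)) = v \<cdot> induced C p q (s \<cdot> d) (\<one> (Dom C d))"
  shows "u = v"
proof -
  note cd = pullback_cospan[OF pb] and pq = pullback_typing[OF pb]
  note ext = comp_eq_extend[OF s(4)] comp_eq_extend[OF t(4)] comp_eq_extend[OF pullback_square[OF pb]]
  define l where "l = induced C p q (\<one> (Dom C c)) (t \<cdot> c)"
  define r where "r = induced C p q (s \<cdot> d) (\<one> (Dom C d))"
  have l: "l \<in> Arr C" "Dom C l = Dom C c" "Cod C l = P" "p \<cdot> l = \<one> (Dom C c)" "q \<cdot> l = t \<cdot> c"
    using induced_props[OF pb, of "\<one> (Dom C c)" "t \<cdot> c"] cd t by (simp_all add: l_def ext)
  have r: "r \<in> Arr C" "Dom C r = Dom C d" "Cod C r = P" "p \<cdot> r = s \<cdot> d" "q \<cdot> r = \<one> (Dom C d)"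
    using induced_props[OF pb, of "s \<cdot> d" "\<one> (Dom C d)"] cd s by (simp_all add: r_def ext)
  have "\<exists>n. is_equaliser C u v n" using uv by (intro equaliser_exists) simp_all
  then obtain n where equ: "is_equaliser C u v n" by blast
  note n = equaliser_typing[OF equ, unfolded uv(3)]
  obtain l' where l': "l' \<in> Arr C" "Dom C l' = Dom C c" "Cod C l' = Dom C n" "n \<cdot> l' = l"
    using equaliser_lift[OF equ l(1) _ eq_l[folded l_def]] l(2,3) uv(3) by metis
  obtain r' where r': "r' \<in> Arr C" "Dom C r' = Dom C d" "Cod C r' = Dom C n" "n \<cdot> r' = r"
    using equaliser_lift[OF equ r(1) _ eq_r[folded r_def]] r(2,3) uv(3) by metis
  obtain k where ker: "is_kernel C d k" using kernel_exists cd(2) by blast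
  note k = kernel_typing(2-)[OF ker]
  note ext' = ext comp_eq_extend[OF l(4)] comp_eq_extend[OF l(5)] comp_eq_extend[OF r(4)]
    comp_eq_extend[OF r(5)] comp_eq_extend[OF l'(4)] comp_eq_extend[OF r'(4)]
    comp_eq_extend[OF k(3)]
  have ker_p: "is_kernel C p (r \<cdot> k)"
  proof (rule is_kernelI)
    show "p \<cdot> (r \<cdot> k) = zero_mor C (Dom C (r \<cdot> k)) (Cod C p)"
      using cd pq r k s by (simp add: ext')
  next
    fix x assume x: "x \<in> Arr C" "Cod C x = Dom C p" "p \<cdot> x = zero_mor C (Dom C x) (Cod C p)"
    have "d \<cdot> (q \<cdot> x) = c \<cdot> (p \<cdot> x)"
      using cd pq x(1,2) by (simp add: ext')
    then have dq: "d \<cdot> (q \<cdot> x) = zero_mor C (Dom C (q \<cdot> x)) (Cod C d)"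
      using cd pq x by simp
    then obtain h where h: "h \<in> Arr C" "Dom C h = Dom C x" "Cod C h = Dom C k" "k \<cdot> h = q \<cdot> x"
      using kernel_lift[OF ker, of "q \<cdot> x"] cd pq x(1,2) by (metis comp_typing)
    have "(r \<cdot> k) \<cdot> h = x"
    proof (rule pullback_eqI[OF pb])
      show "p \<cdot> ((r \<cdot> k) \<cdot> h) = p \<cdot> x"
        using cd pq x dq r k s h by (simp add: ext')
      show "q \<cdot> ((r \<cdot> k) \<cdot> h) = q \<cdot> x"
        using cd pq x(1,2) r k h by (simp add: ext')
    qed (use cd pq x(1,2) r k h(1-3) in simp_all)
    then show "\<exists>h. h \<in> Arr C \<and> Dom C h = Dom C x \<and> Cod C h = Dom C (r \<cdot> k) \<and> (r \<cdot> k) \<cdot> h = x"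
      using h r k by (intro exI[of _ h]) simp
  next
    fix h h' assume h: "h \<in> Arr C" "h' \<in> Arr C" "Dom C h = Dom C h'" "Cod C h = Dom C (r \<cdot> k)"
      "Cod C h' = Dom C (r \<cdot> k)" "(r \<cdot> k) \<cdot> h = (r \<cdot> k) \<cdot> h'"
    have hk: "Cod C h = Dom C k" "Cod C h' = Dom C k" using h(4,5) r k by simp_all
    have "q \<cdot> ((r \<cdot> k) \<cdot> h) = q \<cdot> ((r \<cdot> k) \<cdot> h')" by (simp only: h(6))
    then have "k \<cdot> h = k \<cdot> h'" using cd pq r k h(1,2) hk by (simp add: ext')
    then show "h = h'" using h(1-3) hk by - (rule kernel_cancel[OF ker]; simp)
  qed (use cd pq r k in simp_all)
  have ker_pn: "is_kernel C (p \<cdot> n) (r' \<cdot> k)"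
  proof (rule is_kernelI)
    show "(p \<cdot> n) \<cdot> (r' \<cdot> k) = zero_mor C (Dom C (r' \<cdot> k)) (Cod C (p \<cdot> n))"
      using cd pq n r r' k s by (simp add: ext')
  next
    fix x assume x: "x \<in> Arr C" "Cod C x = Dom C (p \<cdot> n)"
      "(p \<cdot> n) \<cdot> x = zero_mor C (Dom C x) (Cod C (p \<cdot> n))"
    have xn: "Cod C x = Dom C n" using x(2) pq n by simp
    have "p \<cdot> (n \<cdot> x) = zero_mor C (Dom C (n \<cdot> x)) (Cod C p)" using x(1,3) xn pq n by simp
    then obtain h where h: "h \<in> Arr C" "Dom C h = Dom C x" "Cod C h = Dom C k" "(r \<cdot> k) \<cdot> h = n \<cdot> x"
      using kernel_lift[OF ker_p, of "n \<cdot> x"] x(1) xn pq n r k by (metis comp_typing)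
    have "(r' \<cdot> k) \<cdot> h = x"
    proof (rule equaliser_cancel[OF equ])
      show "n \<cdot> ((r' \<cdot> k) \<cdot> h) = n \<cdot> x"
        using h r r' k n by (simp add: ext')
    qed (use x(1) xn h(1-3) r' k in simp_all)
    then show "\<exists>h. h \<in> Arr C \<and> Dom C h = Dom C x \<and> Cod C h = Dom C (r' \<cdot> k) \<and> (r' \<cdot> k) \<cdot> h = x"
      using h r' k by (intro exI[of _ h]) simp
  next
    fix h h' assume h: "h \<in> Arr C" "h' \<in> Arr C" "Dom C h = Dom C h'" "Cod C h = Dom C (r' \<cdot> k)"
      "Cod C h' = Dom C (r' \<cdot> k)" "(r' \<cdot> k) \<cdot> h = (r' \<cdot> k) \<cdot> h'"
    have hk: "Cod C h = Dom C k" "Cod C h' = Dom C k" using h(4,5) r' k by simp_all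
    have "n \<cdot> ((r' \<cdot> k) \<cdot> h) = n \<cdot> ((r' \<cdot> k) \<cdot> h')" by (simp only: h(6))
    then have "(r \<cdot> k) \<cdot> h = (r \<cdot> k) \<cdot> h'" using r r' k n h(1,2) hk by (simp add: ext')
    then show "h = h'" using h(1-3) hk r k by - (rule kernel_cancel[OF ker_p]; simp)
  qed (use pq n r' k in simp_all)
  have "isomorphism C n"
  proof -
    have "split_epi_with_section C (Dom C n) (Dom C c) (p \<cdot> n) l'"
      "split_epi_with_section C P (Dom C c) p l"
      "\<one> (Dom C k) \<in> hom C (Dom C (r' \<cdot> k)) (Dom C (r \<cdot> k))"
      "n \<in> hom C (Dom C n) P" "\<one> (Dom C c) \<in> hom C (Dom C c) (Dom C c)"
      "n \<cdot> (r' \<cdot> k) = (r \<cdot> k) \<cdot> \<one> (Dom C k)" "\<one> (Dom C c) \<cdot> (p \<cdot> n) = p \<cdot> n"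
      "l \<cdot> \<one> (Dom C c) = n \<cdot> l'"
      "isomorphism C (\<one> (Dom C k))" "isomorphism C (\<one> (Dom C c))"
      using cd pq l r n l' r' k
      by (simp_all add: split_epi_with_section_def mem_hom_iff isomorphism_id ext')
    with ker_p ker_pn split_short_five show ?thesis
      unfolding split_short_five_lemma_def by blast
  qed
  then obtain g where g: "g \<in> Arr C" "Dom C g = P" "Cod C g = Dom C n" "n \<cdot> g = \<one> P"
    using n(2) unfolding isomorphism_def by (auto simp: mem_hom_iff)
  have "u \<cdot> (n \<cdot> g) = v \<cdot> (n \<cdot> g)"
    using comp_eq_extend[OF n(3), of g] uv n(1,2) g(1-3) by simp
  then show "u = v" using g(4) uv by simp
qed

end

section \<open>Operations on generalised elements\<close>

text \<open>By the Yoneda lemma such an operation is the same as a morphism to \<open>W\<close> from the pullback of \<open>c\<close>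
  and \<open>d\<close>. As an operation it can be composed and compared without choosing a pullback or forming
  induced morphisms.\<close>

definition fibred_operation ::
  "('o, 'm) category \<Rightarrow> 'm \<Rightarrow> 'm \<Rightarrow> 'o \<Rightarrow> ('m \<Rightarrow> 'm \<Rightarrow> 'm) \<Rightarrow> bool" where
  "fibred_operation C c d W F \<longleftrightarrow>
     (\<forall>x y. x \<in> Arr C \<and> y \<in> Arr C \<and> Dom C x = Dom C y \<and> Cod C x = Dom C c \<and> Cod C y = Dom C d \<and>
        c \<cdot>\<^bsub>C\<^esub> x = d \<cdot>\<^bsub>C\<^esub> y \<longrightarrow>
        F x y \<in> hom C (Dom C y) W \<and>
        (\<forall>w \<in> Arr C. Cod C w = Dom C y \<longrightarrow> F x y \<cdot>\<^bsub>C\<^esub> w = F (x \<cdot>\<^bsub>C\<^esub> w) (y \<cdot>\<^bsub>C\<^esub> w)))"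

context category
begin

lemma fibred_operationI:
  assumes "\<And>x y. \<lbrakk>x \<in> Arr C; y \<in> Arr C; Dom C x = Dom C y; Cod C x = Dom C c; Cod C y = Dom C d;
      c \<cdot> x = d \<cdot> y\<rbrakk> \<Longrightarrow> F x y \<in> Arr C \<and> Dom C (F x y) = Dom C y \<and> Cod C (F x y) = W"
    and "\<And>x y w. \<lbrakk>x \<in> Arr C; y \<in> Arr C; Dom C x = Dom C y; Cod C x = Dom C c; Cod C y = Dom C d;
      c \<cdot> x = d \<cdot> y; w \<in> Arr C; Cod C w = Dom C y; c \<cdot> (x \<cdot> w) = d \<cdot> (y \<cdot> w)\<rbrakk>
      \<Longrightarrow> F x y \<cdot> w = F (x \<cdot> w) (y \<cdot> w)"
    and cd: "c \<in> Arr C" "d \<in> Arr C"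
  shows "fibred_operation C c d W F"
  unfolding fibred_operation_def mem_hom_iff
proof (intro allI impI conjI ballI; elim conjE)
  fix x y w
  assume xy: "x \<in> Arr C" "y \<in> Arr C" "Dom C x = Dom C y" "Cod C x = Dom C c" "Cod C y = Dom C d"
    "c \<cdot> x = d \<cdot> y" "w \<in> Arr C" "Cod C w = Dom C y"
  have "c \<cdot> (x \<cdot> w) = d \<cdot> (y \<cdot> w)"
    using comp_eq_extend[OF xy(6), of w] xy(1-5,7,8) cd by simp
  with xy show "F x y \<cdot> w = F (x \<cdot> w) (y \<cdot> w)" by (rule assms(2))
qed (use assms(1) in blast)+

lemma fibred_operation_typing:
  assumes "fibred_operation C c d W F"
    and "x \<in> Arr C" "y \<in> Arr C" "Dom C x = Dom C y" "Cod C x = Dom C c" "Cod C y = Dom C d"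
    and "c \<cdot> x = d \<cdot> y"
  shows "F x y \<in> Arr C" "Dom C (F x y) = Dom C y" "Cod C (F x y) = W"
  using assms unfolding fibred_operation_def mem_hom_iff by blast+

lemma fibred_operation_comp:
  assumes "fibred_operation C c d W F"
    and "x \<in> Arr C" "y \<in> Arr C" "Dom C x = Dom C y" "Cod C x = Dom C c" "Cod C y = Dom C d"
    and "c \<cdot> x = d \<cdot> y" "w \<in> Arr C" "Cod C w = Dom C y"
  shows "F x y \<cdot> w = F (x \<cdot> w) (y \<cdot> w)"
  using assms unfolding fibred_operation_def by blast

lemma fibred_operation_of_morphism:
  assumes pb: "is_pullback C c d P p q" and u: "u \<in> Arr C" "Dom C u = P" "Cod C u = W"
  shows "fibred_operation C c d W (\<lambda>x y. u \<cdot> induced C p q x y)"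
proof (rule fibred_operationI)
  fix x y assume xy: "x \<in> Arr C" "y \<in> Arr C" "Dom C x = Dom C y" "Cod C x = Dom C c"
    "Cod C y = Dom C d" "c \<cdot> x = d \<cdot> y"
  note i = induced_props[OF pb xy(1,4,2,5,3,6)]
  show "u \<cdot> induced C p q x y \<in> Arr C \<and> Dom C (u \<cdot> induced C p q x y) = Dom C y \<and>
      Cod C (u \<cdot> induced C p q x y) = W"
    using u i by simp
  fix w assume w: "w \<in> Arr C" "Cod C w = Dom C y"
  show "(u \<cdot> induced C p q x y) \<cdot> w = u \<cdot> induced C p q (x \<cdot> w) (y \<cdot> w)"
    using u i w induced_comp[OF pb xy(1,4,2,5,3,6) w] by simp
qed (rule pullback_cospan[OF pb])+

text \<open>The value at the universal pair \<open>(p, q)\<close> is the representing morphism.\<close>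

lemma fibred_operation_generic:
  assumes F: "fibred_operation C c d W F" and pb: "is_pullback C c d P p q"
  shows "F p q \<in> Arr C" "Dom C (F p q) = P" "Cod C (F p q) = W"
    and "\<lbrakk>x \<in> Arr C; y \<in> Arr C; Dom C x = Dom C y; Cod C x = Dom C c; Cod C y = Dom C d;
      c \<cdot> x = d \<cdot> y\<rbrakk> \<Longrightarrow> F p q \<cdot> induced C p q x y = F x y"
proof -
  note pq = pullback_typing[OF pb] and sq = pullback_square[OF pb]
  show "F p q \<in> Arr C" "Dom C (F p q) = P" "Cod C (F p q) = W"
    using fibred_operation_typing[OF F, of p q] pq sq by simp_all
  assume xy: "x \<in> Arr C" "y \<in> Arr C" "Dom C x = Dom C y" "Cod C x = Dom C c"
    "Cod C y = Dom C d" "c \<cdot> x = d \<cdot> y"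
  note i = induced_props[OF pb xy(1,4,2,5,3,6)]
  have "F p q \<cdot> induced C p q x y = F (p \<cdot> induced C p q x y) (q \<cdot> induced C p q x y)"
    by (rule fibred_operation_comp[OF F]) (use pq sq i in simp_all)
  then show "F p q \<cdot> induced C p q x y = F x y" by (simp only: i(4,5))
qed

end

context pointed_protomodular_category
begin

text \<open>This is the form in which protomodularity is applied in all that follows.\<close>

lemma fibred_operation_eqI:
  assumes F: "fibred_operation C c d W F" and G: "fibred_operation C c d W G"
    and cd: "c \<in> Arr C" "d \<in> Arr C" "Cod C c = Cod C d"
    and s: "s \<in> Arr C" "Dom C s = Cod C d" "Cod C s = Dom C c" "c \<cdot> s = \<one> (Cod C d)"
    and t: "t \<in> Arr C" "Dom C t = Cod C d" "Cod C t = Dom C d" "d \<cdot> t = \<one> (Cod C d)"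
    and left: "\<And>x. \<lbrakk>x \<in> Arr C; Cod C x = Dom C c\<rbrakk> \<Longrightarrow> F x (t \<cdot> (c \<cdot> x)) = G x (t \<cdot> (c \<cdot> x))"
    and right: "\<And>y. \<lbrakk>y \<in> Arr C; Cod C y = Dom C d\<rbrakk> \<Longrightarrow> F (s \<cdot> (d \<cdot> y)) y = G (s \<cdot> (d \<cdot> y)) y"
    and xy: "x \<in> Arr C" "y \<in> Arr C" "Dom C x = Dom C y" "Cod C x = Dom C c" "Cod C y = Dom C d"
    "c \<cdot> x = d \<cdot> y"
  shows "F x y = G x y"
proof -
  obtain P p q where pb: "is_pullback C c d P p q"
    using pullback_exists[OF finitely_complete cd] by blast
  note F' = fibred_operation_generic[OF F pb] and G' = fibred_operation_generic[OF G pb]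
  note ext = comp_eq_extend[OF s(4)] comp_eq_extend[OF t(4)]
  have "F p q = G p q"
  proof (rule pullback_sections_jointly_epic[OF pb s t F'(1) G'(1) F'(2) G'(2)])
    have "F (\<one> (Dom C c)) (t \<cdot> c) = G (\<one> (Dom C c)) (t \<cdot> c)"
      using left[of "\<one> (Dom C c)"] cd by simp
    then show "F p q \<cdot> induced C p q (\<one> (Dom C c)) (t \<cdot> c) = G p q \<cdot> induced C p q (\<one> (Dom C c)) (t \<cdot> c)"
      using F'(4)[of "\<one> (Dom C c)" "t \<cdot> c"] G'(4)[of "\<one> (Dom C c)" "t \<cdot> c"] cd t ext by simp
    have "F (s \<cdot> d) (\<one> (Dom C d)) = G (s \<cdot> d) (\<one> (Dom C d))"
      using right[of "\<one> (Dom C d)"] cd by simp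
    then show "F p q \<cdot> induced C p q (s \<cdot> d) (\<one> (Dom C d)) = G p q \<cdot> induced C p q (s \<cdot> d) (\<one> (Dom C d))"
      using F'(4)[of "s \<cdot> d" "\<one> (Dom C d)"] G'(4)[of "s \<cdot> d" "\<one> (Dom C d)"] cd s ext by simp
  qed (use F'(3) G'(3) in simp)
  then show ?thesis using F'(4)[OF xy] G'(4)[OF xy] by simp
qed

end

section \<open>Commutation and groupoids on generalised elements\<close>

context category
begin

text \<open>Equations between morphisms out of the pullback need only be supplied at the generic elements
  \<open>\<one> R\<close> and \<open>\<one> S\<close>; conversely, \<open>smith_commuteE\<close> returns them at every generalised element.\<close>

lemma smith_commuteI:
  assumes T: "fibred_operation C r1 s0 A T"
    and r: "r0 \<in> Arr C" "r1 \<in> Arr C" "Dom C r0 = R" "Dom C r1 = R" "Cod C r0 = A" "Cod C r1 = A"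
    and s: "s0 \<in> Arr C" "s1 \<in> Arr C" "Dom C s0 = S" "Dom C s1 = S" "Cod C s0 = A" "Cod C s1 = A"
    and DR: "\<Delta>R \<in> Arr C" "Dom C \<Delta>R = A" "Cod C \<Delta>R = R" "r1 \<cdot> \<Delta>R = \<one> A"
    and DS: "\<Delta>S \<in> Arr C" "Dom C \<Delta>S = A" "Cod C \<Delta>S = S" "s0 \<cdot> \<Delta>S = \<one> A"
    and pb: "is_pullback C r1 s0 P p q"
    and left: "T (\<one> R) (\<Delta>S \<cdot> r1) = r0" and right: "T (\<Delta>R \<cdot> s0) (\<one> S) = s1"
  shows "smith_commute C A R r0 r1 \<Delta>R S s0 s1 \<Delta>S"
proof -
  note T' = fibred_operation_generic[OF T pb]
  note ext = comp_eq_extend[OF DR(4)] comp_eq_extend[OF DS(4)]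
  have RS: "R \<in> Obj C" "S \<in> Obj C" "A \<in> Obj C" using r s cod_in_obj dom_in_obj by blast+
  have "T p q \<cdot> induced C p q (\<one> R) (\<Delta>S \<cdot> r1) = r0"
    using T'(4)[of "\<one> R" "\<Delta>S \<cdot> r1"] RS r s DS ext left by simp
  moreover have "T p q \<cdot> induced C p q (\<Delta>R \<cdot> s0) (\<one> S) = s1"
    using T'(4)[of "\<Delta>R \<cdot> s0" "\<one> S"] RS r s DR ext right by simp
  moreover have "T p q \<in> hom C P A" using T'(1-3) by (simp add: mem_hom_iff)
  ultimately show ?thesis unfolding smith_commute_def using pb by blast
qed

lemma smith_commuteE:
  assumes smith: "smith_commute C A R r0 r1 \<Delta>R S s0 s1 \<Delta>S"
    and r: "r1 \<in> Arr C" "Dom C r1 = R" "Cod C r1 = A"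
    and s: "s0 \<in> Arr C" "Dom C s0 = S" "Cod C s0 = A"
    and DR: "\<Delta>R \<in> Arr C" "Dom C \<Delta>R = A" "Cod C \<Delta>R = R" "r1 \<cdot> \<Delta>R = \<one> A"
    and DS: "\<Delta>S \<in> Arr C" "Dom C \<Delta>S = A" "Cod C \<Delta>S = S" "s0 \<cdot> \<Delta>S = \<one> A"
  obtains T where "fibred_operation C r1 s0 A T"
    "\<And>x. \<lbrakk>x \<in> Arr C; Cod C x = R\<rbrakk> \<Longrightarrow> T x (\<Delta>S \<cdot> (r1 \<cdot> x)) = r0 \<cdot> x"
    "\<And>y. \<lbrakk>y \<in> Arr C; Cod C y = S\<rbrakk> \<Longrightarrow> T (\<Delta>R \<cdot> (s0 \<cdot> y)) y = s1 \<cdot> y"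
proof -
  obtain P p q \<theta> where pb: "is_pullback C r1 s0 P p q" and \<theta>: "\<theta> \<in> hom C P A"
    and left: "\<theta> \<cdot> induced C p q (\<one> R) (\<Delta>S \<cdot> r1) = r0"
    and right: "\<theta> \<cdot> induced C p q (\<Delta>R \<cdot> s0) (\<one> S) = s1"
    using smith unfolding smith_commute_def by blast
  have \<theta>': "\<theta> \<in> Arr C" "Dom C \<theta> = P" "Cod C \<theta> = A" using \<theta> by (simp_all add: mem_hom_iff)
  have RS: "R \<in> Obj C" "S \<in> Obj C" "A \<in> Obj C" using r s cod_in_obj dom_in_obj by blast+
  note ext = comp_eq_extend[OF DR(4)] comp_eq_extend[OF DS(4)]
  define T where "T x y = \<theta> \<cdot> induced C p q x y" for x y
  have T: "fibred_operation C r1 s0 A T"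
    unfolding T_def by (rule fibred_operation_of_morphism[OF pb \<theta>'])
  have "T x (\<Delta>S \<cdot> (r1 \<cdot> x)) = r0 \<cdot> x" if x: "x \<in> Arr C" "Cod C x = R" for x
  proof -
    have "T (\<one> R) (\<Delta>S \<cdot> r1) \<cdot> x = T (\<one> R \<cdot> x) ((\<Delta>S \<cdot> r1) \<cdot> x)"
      by (rule fibred_operation_comp[OF T]) (use RS r s DS ext x in simp_all)
    then show ?thesis using left r DS x by (simp add: T_def)
  qed
  moreover have "T (\<Delta>R \<cdot> (s0 \<cdot> y)) y = s1 \<cdot> y" if y: "y \<in> Arr C" "Cod C y = S" for y
  proof -
    have "T (\<Delta>R \<cdot> s0) (\<one> S) \<cdot> y = T ((\<Delta>R \<cdot> s0) \<cdot> y) (\<one> S \<cdot> y)"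
      by (rule fibred_operation_comp[OF T]) (use RS r s DR ext y in simp_all)
    then show ?thesis using right s DR y by (simp add: T_def)
  qed
  ultimately show thesis using T that by blast
qed

lemma reflexive_graph_typing:
  assumes "reflexive_graph C C1 C0 d c e"
  shows "C1 \<in> Obj C" "C0 \<in> Obj C" "d \<in> Arr C" "Dom C d = C1" "Cod C d = C0"
    "c \<in> Arr C" "Dom C c = C1" "Cod C c = C0" "e \<in> Arr C" "Dom C e = C0" "Cod C e = C1"
    "d \<cdot> e = \<one> C0" "c \<cdot> e = \<one> C0"
  using assms by (simp_all add: reflexive_graph_def mem_hom_iff)

end

text \<open>In this form associativity can be applied to three arrows without passing to the pullback of
  composable triples.\<close>

locale groupoid_elements = category +
  fixes C1 C0 d c e m i
  assumes graph: "reflexive_graph C C1 C0 d c e"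
    and m: "fibred_operation C c d C1 m"
    and d_m: "\<lbrakk>x \<in> Arr C; y \<in> Arr C; Dom C x = Dom C y; Cod C x = C1; Cod C y = C1; c \<cdot> x = d \<cdot> y\<rbrakk>
      \<Longrightarrow> d \<cdot> m x y = d \<cdot> x"
    and c_m: "\<lbrakk>x \<in> Arr C; y \<in> Arr C; Dom C x = Dom C y; Cod C x = C1; Cod C y = C1; c \<cdot> x = d \<cdot> y\<rbrakk>
      \<Longrightarrow> c \<cdot> m x y = c \<cdot> y"
    and unit_left: "\<lbrakk>x \<in> Arr C; Cod C x = C1\<rbrakk> \<Longrightarrow> m (e \<cdot> (d \<cdot> x)) x = x"
    and unit_right: "\<lbrakk>x \<in> Arr C; Cod C x = C1\<rbrakk> \<Longrightarrow> m x (e \<cdot> (c \<cdot> x)) = x"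
    and m_assoc: "\<lbrakk>x \<in> Arr C; y \<in> Arr C; z \<in> Arr C; Dom C x = Dom C z; Dom C y = Dom C z;
      Cod C x = C1; Cod C y = C1; Cod C z = C1; c \<cdot> x = d \<cdot> y; c \<cdot> y = d \<cdot> z\<rbrakk>
      \<Longrightarrow> m (m x y) z = m x (m y z)"
    and i: "i \<in> Arr C" "Dom C i = C1" "Cod C i = C1" "d \<cdot> i = c" "c \<cdot> i = d"
    and inv_right: "\<lbrakk>x \<in> Arr C; Cod C x = C1\<rbrakk> \<Longrightarrow> m x (i \<cdot> x) = e \<cdot> (d \<cdot> x)"
    and inv_left: "\<lbrakk>x \<in> Arr C; Cod C x = C1\<rbrakk> \<Longrightarrow> m (i \<cdot> x) x = e \<cdot> (c \<cdot> x)"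
begin

lemmas graph_typing = reflexive_graph_typing[OF graph]

text \<open>As in a group: \<open>y = (x\<^sup>-\<^sup>1 x) y = x\<^sup>-\<^sup>1 (x y) = x\<^sup>-\<^sup>1\<close>.\<close>

lemma inverse_unique:
  assumes xy: "x \<in> Arr C" "y \<in> Arr C" "Dom C x = Dom C y" "Cod C x = C1" "Cod C y = C1" "c \<cdot> x = d \<cdot> y"
    and eq: "m x y = e \<cdot> (d \<cdot> x)"
  shows "i \<cdot> x = y"
proof -
  note g = graph_typing
  note i_ext = comp_eq_extend[OF i(4)] comp_eq_extend[OF i(5)]
  have "y = m (e \<cdot> (c \<cdot> x)) y" using unit_left[OF xy(2,5)] xy(6) by simp
  also have "\<dots> = m (m (i \<cdot> x) x) y" using inv_left[OF xy(1,4)] by simp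
  also have "\<dots> = m (i \<cdot> x) (m x y)"
    by (rule m_assoc) (use xy g i i_ext in simp_all)
  also have "\<dots> = m (i \<cdot> x) (e \<cdot> (c \<cdot> (i \<cdot> x)))" using xy g i by (simp add: eq i_ext)
  also have "\<dots> = i \<cdot> x" by (rule unit_right) (use xy g i in simp_all)
  finally show ?thesis by simp
qed

end

context category
begin

lemma is_groupoidE:
  assumes "is_groupoid C C1 C0 d c e"
  obtains m i where "groupoid_elements C C1 C0 d c e m i"
proof -
  obtain P p q \<mu> i where gpd: "internal_groupoid C C1 C0 d c e P p q \<mu> i"
    using assms unfolding is_groupoid_def by blast
  then have cat: "internal_category C C1 C0 d c e P p q \<mu>"
    and "i \<in> hom C C1 C1" and di: "d \<cdot> i = c" "c \<cdot> i = d"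
    and inv: "\<mu> \<cdot> induced C p q (\<one> C1) i = e \<cdot> d" "\<mu> \<cdot> induced C p q i (\<one> C1) = e \<cdot> c"
    unfolding internal_groupoid_def by blast+
  then have i: "i \<in> Arr C" "Dom C i = C1" "Cod C i = C1" by (simp_all add: mem_hom_iff)
  obtain T t u where graph: "reflexive_graph C C1 C0 d c e"
    and pb: "is_pullback C c d P p q" and "\<mu> \<in> hom C P C1"
    and d\<mu>: "d \<cdot> \<mu> = d \<cdot> p" "c \<cdot> \<mu> = c \<cdot> q"
    and unit: "\<mu> \<cdot> induced C p q (e \<cdot> d) (\<one> C1) = \<one> C1" "\<mu> \<cdot> induced C p q (\<one> C1) (e \<cdot> c) = \<one> C1"
    and pb': "is_pullback C q p T t u"
    and assoc\<mu>: "\<mu> \<cdot> induced C p q (\<mu> \<cdot> t) (q \<cdot> u) = \<mu> \<cdot> induced C p q (p \<cdot> t) (\<mu> \<cdot> u)"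
    using cat unfolding internal_category_def by blast
  then have \<mu>: "\<mu> \<in> Arr C" "Dom C \<mu> = P" "Cod C \<mu> = C1" by (simp_all add: mem_hom_iff)
  note g = reflexive_graph_typing[OF graph]
  note pq = pullback_typing[OF pb, unfolded g] and tu = pullback_typing[OF pb', unfolded pullback_typing(3,6)[OF pb]]
  note sq = pullback_square[OF pb] and sq' = pullback_square[OF pb']
  note ext = comp_eq_extend[OF g(12)] comp_eq_extend[OF g(13)] comp_eq_extend[OF di(1)]
    comp_eq_extend[OF di(2)] comp_eq_extend[OF d\<mu>(1)] comp_eq_extend[OF d\<mu>(2)]
  define m where "m x y = \<mu> \<cdot> induced C p q x y" for x y
  have m: "fibred_operation C c d C1 m"
    unfolding m_def by (rule fibred_operation_of_morphism[OF pb \<mu>])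
  note mtyp = fibred_operation_typing[OF m, unfolded g] and mcomp = fibred_operation_comp[OF m, unfolded g]
  have dcm: "d \<cdot> m x y = d \<cdot> x \<and> c \<cdot> m x y = c \<cdot> y"
    if xy: "x \<in> Arr C" "y \<in> Arr C" "Dom C x = Dom C y" "Cod C x = C1" "Cod C y = C1" "c \<cdot> x = d \<cdot> y"
    for x y
  proof -
    have j: "induced C p q x y \<in> Arr C" "Cod C (induced C p q x y) = P"
      "p \<cdot> induced C p q x y = x" "q \<cdot> induced C p q x y = y"
      using induced_props[OF pb, of x y] xy g by simp_all
    then show ?thesis using \<mu> pq g by (simp add: m_def ext)
  qed
  have unit_left: "m (e \<cdot> (d \<cdot> x)) x = x" if x: "x \<in> Arr C" "Cod C x = C1" for x
    using mcomp[of "e \<cdot> d" "\<one> C1" x] unit(1) x g by (simp add: m_def ext)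
  have unit_right: "m x (e \<cdot> (c \<cdot> x)) = x" if x: "x \<in> Arr C" "Cod C x = C1" for x
    using mcomp[of "\<one> C1" "e \<cdot> c" x] unit(2) x g by (simp add: m_def ext)
  have inv_right: "m x (i \<cdot> x) = e \<cdot> (d \<cdot> x)" if x: "x \<in> Arr C" "Cod C x = C1" for x
    using mcomp[of "\<one> C1" i x] inv(1) x g i di by (simp add: m_def)
  have inv_left: "m (i \<cdot> x) x = e \<cdot> (c \<cdot> x)" if x: "x \<in> Arr C" "Cod C x = C1" for x
    using mcomp[of i "\<one> C1" x] inv(2) x g i di by (simp add: m_def)
  have massoc: "m (m x y) z = m x (m y z)"
    if xyz: "x \<in> Arr C" "y \<in> Arr C" "z \<in> Arr C" "Dom C x = Dom C z" "Dom C y = Dom C z"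
      "Cod C x = C1" "Cod C y = C1" "Cod C z = C1" "c \<cdot> x = d \<cdot> y" "c \<cdot> y = d \<cdot> z" for x y z
  proof -
    define a where "a = induced C p q x y"
    define b where "b = induced C p q y z"
    define w where "w = induced C t u a b"
    have a: "a \<in> Arr C" "Dom C a = Dom C z" "Cod C a = P" "p \<cdot> a = x" "q \<cdot> a = y"
      using induced_props[OF pb, of x y] xyz g by (simp_all add: a_def)
    have b: "b \<in> Arr C" "Dom C b = Dom C z" "Cod C b = P" "p \<cdot> b = y" "q \<cdot> b = z"
      using induced_props[OF pb, of y z] xyz g by (simp_all add: b_def)
    have w: "w \<in> Arr C" "Dom C w = Dom C z" "Cod C w = T" "t \<cdot> w = a" "u \<cdot> w = b"
      using induced_props[OF pb', of a b] a b pq by (simp_all add: w_def)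
    have \<mu>ab: "\<mu> \<cdot> a = m x y" "\<mu> \<cdot> b = m y z" by (simp_all add: m_def a_def b_def)
    have cdt: "c \<cdot> (\<mu> \<cdot> t) = d \<cdot> (q \<cdot> u)" "c \<cdot> (p \<cdot> t) = d \<cdot> (\<mu> \<cdot> u)"
      using comp_eq_extend[OF d\<mu>(2), of t] comp_eq_extend[OF d\<mu>(1), of u] sq'
        comp_eq_extend[OF sq, of u] comp_eq_extend[OF sq, of t] \<mu> pq tu g by simp_all
    have "m (\<mu> \<cdot> t) (q \<cdot> u) \<cdot> w = m (p \<cdot> t) (\<mu> \<cdot> u) \<cdot> w"
      using assoc\<mu> by (simp add: m_def)
    then show ?thesis
      using mcomp[of "\<mu> \<cdot> t" "q \<cdot> u" w] mcomp[of "p \<cdot> t" "\<mu> \<cdot> u" w] cdt w a b \<mu>ab \<mu> pq tu g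
      by simp
  qed
  have "groupoid_elements C C1 C0 d c e m i"
    by unfold_locales (fact graph m unit_left unit_right massoc i di inv_right inv_left | simp add: dcm)+
  then show thesis by (rule that)
qed

end

context pointed_protomodular_category
begin

text \<open>Over a zero object the fibre condition is void, and zero morphisms split the morphisms to it. So
  the Huq connecting morphism is a fibred operation as well, and the injections
  \<open>\<langle>1, 0\<rangle>\<close> and \<open>\<langle>0, 1\<rangle>\<close> are the two sections to which extensionality refers.\<close>

lemma is_product_iff_pullback:
  assumes "zero_object C N" "X \<in> Obj C" "Y \<in> Obj C"
  shows "is_product C X Y P p q \<longleftrightarrow> is_pullback C (zero_mor C X N) (zero_mor C Y N) P p q"
proof -
  have N: "N \<in> Obj C" using assms(1) unfolding zero_object_def by (rule conjunct1)
  have "zero_mor C X N \<cdot> x = zero_mor C Z N" if "x \<in> hom C Z X" for x Z X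
    using that N by (auto simp: mem_hom_iff)
  then show ?thesis
    unfolding is_product_def is_pullback_def using assms(2,3) N by (simp cong: conj_cong)
qed

lemma huq_commuteI:
  assumes N: "zero_object C N"
    and kl: "k \<in> Arr C" "l \<in> Arr C" "Cod C k = Cod C l"
    and T: "fibred_operation C (zero_mor C (Dom C k) N) (zero_mor C (Dom C l) N) (Cod C l) T"
    and left: "T (\<one> (Dom C k)) (zero_mor C (Dom C k) (Dom C l)) = k"
    and right: "T (zero_mor C (Dom C l) (Dom C k)) (\<one> (Dom C l)) = l"
  shows "huq_commute C k l"
proof -
  have XY: "Dom C k \<in> Obj C" "Dom C l \<in> Obj C" "N \<in> Obj C"
    using kl N unfolding zero_object_def by (simp_all (no_asm_simp))
  obtain P p q where pb: "is_pullback C (zero_mor C (Dom C k) N) (zero_mor C (Dom C l) N) P p q"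
    using pullback_exists[OF finitely_complete, of "zero_mor C (Dom C k) N" "zero_mor C (Dom C l) N"]
      XY by auto
  note T' = fibred_operation_generic[OF T pb]
  have "T p q \<cdot> induced C p q (\<one> (Dom C k)) (zero_mor C (Dom C k) (Dom C l)) = k"
    "T p q \<cdot> induced C p q (zero_mor C (Dom C l) (Dom C k)) (\<one> (Dom C l)) = l"
    using XY left right by (simp_all add: T'(4))
  moreover have "T p q \<in> hom C P (Cod C k)" using T'(1-3) kl by (simp add: mem_hom_iff)
  moreover have "is_product C (Dom C k) (Dom C l) P p q"
    using pb is_product_iff_pullback[OF N XY(1,2)] by blast
  ultimately show ?thesis unfolding huq_commute_def Let_def using kl by blast
qed

lemma huq_commuteE:
  assumes huq: "huq_commute C k l" and N: "zero_object C N"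
  obtains T where
    "fibred_operation C (zero_mor C (Dom C k) N) (zero_mor C (Dom C l) N) (Cod C l) T"
    "\<And>x. \<lbrakk>x \<in> Arr C; Cod C x = Dom C k\<rbrakk> \<Longrightarrow> T x (zero_mor C (Dom C x) (Dom C l)) = k \<cdot> x"
    "\<And>y. \<lbrakk>y \<in> Arr C; Cod C y = Dom C l\<rbrakk> \<Longrightarrow> T (zero_mor C (Dom C y) (Dom C k)) y = l \<cdot> y"
proof -
  have kl: "k \<in> Arr C" "l \<in> Arr C" "Cod C k = Cod C l" using huq unfolding huq_commute_def by blast+
  have XY: "Dom C k \<in> Obj C" "Dom C l \<in> Obj C" using kl by simp_all
  have NO: "N \<in> Obj C" using N unfolding zero_object_def by (rule conjunct1)
  obtain P p q \<phi> where prod: "is_product C (Dom C k) (Dom C l) P p q" and \<phi>: "\<phi> \<in> hom C P (Cod C k)"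
    and left: "\<phi> \<cdot> induced C p q (\<one> (Dom C k)) (zero_mor C (Dom C k) (Dom C l)) = k"
    and right: "\<phi> \<cdot> induced C p q (zero_mor C (Dom C l) (Dom C k)) (\<one> (Dom C l)) = l"
    using huq unfolding huq_commute_def Let_def by blast
  have \<phi>': "\<phi> \<in> Arr C" "Dom C \<phi> = P" "Cod C \<phi> = Cod C l" using \<phi> kl by (simp_all add: mem_hom_iff)
  have pb: "is_pullback C (zero_mor C (Dom C k) N) (zero_mor C (Dom C l) N) P p q"
    using prod is_product_iff_pullback[OF N XY] by blast
  define T where "T x y = \<phi> \<cdot> induced C p q x y" for x y
  have T: "fibred_operation C (zero_mor C (Dom C k) N) (zero_mor C (Dom C l) N) (Cod C l) T"
    unfolding T_def by (rule fibred_operation_of_morphism[OF pb \<phi>'])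
  have "T x (zero_mor C (Dom C x) (Dom C l)) = k \<cdot> x" if x: "x \<in> Arr C" "Cod C x = Dom C k" for x
  proof -
    have "T (\<one> (Dom C k)) (zero_mor C (Dom C k) (Dom C l)) \<cdot> x =
        T (\<one> (Dom C k) \<cdot> x) (zero_mor C (Dom C k) (Dom C l) \<cdot> x)"
      by (rule fibred_operation_comp[OF T]) (use XY NO x in simp_all)
    then show ?thesis using left XY x by (simp add: T_def)
  qed
  moreover have "T (zero_mor C (Dom C y) (Dom C k)) y = l \<cdot> y" if y: "y \<in> Arr C" "Cod C y = Dom C l" for y
  proof -
    have "T (zero_mor C (Dom C l) (Dom C k)) (\<one> (Dom C l)) \<cdot> y =
        T (zero_mor C (Dom C l) (Dom C k) \<cdot> y) (\<one> (Dom C l) \<cdot> y)"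
      by (rule fibred_operation_comp[OF T]) (use XY NO y in simp_all)
    then show ?thesis using right XY y by (simp add: T_def)
  qed
  ultimately show thesis using T that by blast
qed

text \<open>Associativity follows from the unit laws. Both bracketings are operations on pairs of composable
  pairs \<open>((x, y), (y, z))\<close>, hence determined by the cases in which \<open>x\<close> or \<open>z\<close> is an identity, and there
  they agree.\<close>

lemma is_groupoidI:
  assumes graph: "reflexive_graph C C1 C0 d c e"
    and m: "fibred_operation C c d C1 m"
    and dcm: "\<And>x y. \<lbrakk>x \<in> Arr C; y \<in> Arr C; Dom C x = Dom C y; Cod C x = C1; Cod C y = C1;
      c \<cdot> x = d \<cdot> y\<rbrakk> \<Longrightarrow> d \<cdot> m x y = d \<cdot> x \<and> c \<cdot> m x y = c \<cdot> y"
    and unit_left: "\<And>x. \<lbrakk>x \<in> Arr C; Cod C x = C1\<rbrakk> \<Longrightarrow> m (e \<cdot> (d \<cdot> x)) x = x"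
    and unit_right: "\<And>x. \<lbrakk>x \<in> Arr C; Cod C x = C1\<rbrakk> \<Longrightarrow> m x (e \<cdot> (c \<cdot> x)) = x"
    and i: "i \<in> Arr C" "Dom C i = C1" "Cod C i = C1" "d \<cdot> i = c" "c \<cdot> i = d"
    and inv_right: "m (\<one> C1) i = e \<cdot> d" and inv_left: "m i (\<one> C1) = e \<cdot> c"
  shows "is_groupoid C C1 C0 d c e"
proof -
  note g = reflexive_graph_typing[OF graph]
  have "\<exists>P p q. is_pullback C c d P p q"
    using g by (simp add: pullback_exists finitely_complete)
  then obtain P p q where pb: "is_pullback C c d P p q" by blast
  note pq = pullback_typing[OF pb, unfolded g] and sq = pullback_square[OF pb]
  note mtyp = fibred_operation_typing[OF m, unfolded g] and mcomp = fibred_operation_comp[OF m, unfolded g]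
  note mgen = fibred_operation_generic[OF m pb, unfolded g]
  note ext = comp_eq_extend[OF g(12)] comp_eq_extend[OF g(13)]
  have "\<exists>T t u. is_pullback C q p T t u"
    using pq by (simp add: pullback_exists finitely_complete)
  then obtain T t u where pb': "is_pullback C q p T t u" by blast
  note tu = pullback_typing[OF pb', unfolded pq] and sq' = pullback_square[OF pb']
  have dcpq: "d \<cdot> m p q = d \<cdot> p" "c \<cdot> m p q = c \<cdot> q"
    using dcm[of p q] pq sq by simp_all
  \<comment> \<open>The pairs \<open>(1, x)\<close> and \<open>(x, 1)\<close> that split the two projections between composable pairs.\<close>
  define s where "s = induced C p q (e \<cdot> d) (\<one> C1)"
  define s' where "s' = induced C p q (\<one> C1) (e \<cdot> c)"
  have s: "s \<in> Arr C" "Dom C s = C1" "Cod C s = P" "p \<cdot> s = e \<cdot> d" "q \<cdot> s = \<one> C1"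
    using induced_props[OF pb, of "e \<cdot> d" "\<one> C1"] g by (simp_all add: s_def ext)
  have s': "s' \<in> Arr C" "Dom C s' = C1" "Cod C s' = P" "p \<cdot> s' = \<one> C1" "q \<cdot> s' = e \<cdot> c"
    using induced_props[OF pb, of "\<one> C1" "e \<cdot> c"] g by (simp_all add: s'_def ext)
  define F where "F a b = m (m (p \<cdot> a) (q \<cdot> a)) (q \<cdot> b)" for a b
  define G where "G a b = m (p \<cdot> a) (m (p \<cdot> b) (q \<cdot> b))" for a b
  have sqx: "c \<cdot> (p \<cdot> a) = d \<cdot> (q \<cdot> a)" if "a \<in> Arr C" "Cod C a = P" for a
    using comp_eq_extend[OF sq, of a] that pq g by simp
  have F: "fibred_operation C q p C1 F"
    unfolding F_def by (rule fibred_operationI) (use g pq sqx in \<open>simp_all add: mtyp dcm mcomp\<close>)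
  have G: "fibred_operation C q p C1 G"
    unfolding G_def by (rule fibred_operationI) (use g pq sqx in \<open>simp_all add: mtyp dcm mcomp\<close>)
  have FG: "F t u = G t u"
  proof (rule fibred_operation_eqI[OF F G])
    fix x assume x: "x \<in> Arr C" "Cod C x = Dom C q"
    show "F x (s' \<cdot> (q \<cdot> x)) = G x (s' \<cdot> (q \<cdot> x))"
    proof -
      have px: "p \<cdot> x \<in> Arr C" "Cod C (p \<cdot> x) = C1" "Dom C (p \<cdot> x) = Dom C (q \<cdot> x)"
        "q \<cdot> x \<in> Arr C" "Cod C (q \<cdot> x) = C1" "c \<cdot> (p \<cdot> x) = d \<cdot> (q \<cdot> x)"
        using x g pq sqx by simp_all
      note mx = mtyp[OF px(1,4,3,2,5,6)] and dcx = dcm[OF px(1,4,3,2,5,6)]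
      have "p \<cdot> (s' \<cdot> (q \<cdot> x)) = q \<cdot> x" "q \<cdot> (s' \<cdot> (q \<cdot> x)) = e \<cdot> (c \<cdot> (q \<cdot> x))"
        using x g pq s' comp_eq_extend[OF s'(4)] comp_eq_extend[OF s'(5)] by simp_all
      then show ?thesis
        unfolding F_def G_def using unit_right[OF mx(1,3)] unit_right[OF px(4,5)] dcx by simp
    qed
  next
    fix y assume y: "y \<in> Arr C" "Cod C y = Dom C p"
    show "F (s \<cdot> (p \<cdot> y)) y = G (s \<cdot> (p \<cdot> y)) y"
    proof -
      have py: "p \<cdot> y \<in> Arr C" "Cod C (p \<cdot> y) = C1" "Dom C (p \<cdot> y) = Dom C (q \<cdot> y)"
        "q \<cdot> y \<in> Arr C" "Cod C (q \<cdot> y) = C1" "c \<cdot> (p \<cdot> y) = d \<cdot> (q \<cdot> y)"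
        using y g pq sqx by simp_all
      note my = mtyp[OF py(1,4,3,2,5,6)] and dcy = dcm[OF py(1,4,3,2,5,6)]
      have "p \<cdot> (s \<cdot> (p \<cdot> y)) = e \<cdot> (d \<cdot> (p \<cdot> y))" "q \<cdot> (s \<cdot> (p \<cdot> y)) = p \<cdot> y"
        using y g pq s comp_eq_extend[OF s(4)] comp_eq_extend[OF s(5)] by simp_all
      then show ?thesis
        unfolding F_def G_def using unit_left[OF my(1,3)] unit_left[OF py(1,2)] dcy by simp
    qed
  qed (use g pq tu sq' s s' in simp_all)
  have "internal_category C C1 C0 d c e P p q (m p q)"
    unfolding internal_category_def
  proof (intro conjI)
    show "m p q \<in> hom C P C1" using mgen(1-3) by (simp add: mem_hom_iff)
    show "m p q \<cdot> induced C p q (e \<cdot> d) (\<one> C1) = \<one> C1"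
      using mgen(4)[of "e \<cdot> d" "\<one> C1"] unit_left[of "\<one> C1"] g ext by simp
    show "m p q \<cdot> induced C p q (\<one> C1) (e \<cdot> c) = \<one> C1"
      using mgen(4)[of "\<one> C1" "e \<cdot> c"] unit_right[of "\<one> C1"] g ext by simp
    have "m p q \<cdot> induced C p q (m p q \<cdot> t) (q \<cdot> u) = m p q \<cdot> induced C p q (p \<cdot> t) (m p q \<cdot> u)"
    proof -
      have mt: "m p q \<cdot> t = m (p \<cdot> t) (q \<cdot> t)" "m p q \<cdot> u = m (p \<cdot> u) (q \<cdot> u)"
        using mcomp[of p q t] mcomp[of p q u] pq sq tu by simp_all
      have cd: "c \<cdot> (m p q \<cdot> t) = d \<cdot> (q \<cdot> u)" "c \<cdot> (p \<cdot> t) = d \<cdot> (m p q \<cdot> u)"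
        using comp_eq_extend[OF dcpq(2), of t] comp_eq_extend[OF dcpq(1), of u]
          sq' sqx[of t] sqx[of u] mgen(1-3) pq tu g by simp_all
      have "m p q \<cdot> induced C p q (m p q \<cdot> t) (q \<cdot> u) = m (m p q \<cdot> t) (q \<cdot> u)"
        "m p q \<cdot> induced C p q (p \<cdot> t) (m p q \<cdot> u) = m (p \<cdot> t) (m p q \<cdot> u)"
        by (rule mgen(4); use cd mgen(1-3) pq tu g in simp)+
      then show ?thesis using FG by (simp only: mt F_def G_def)
    qed
    with pb' show "\<exists>T t u. is_pullback C q p T t u \<and>
        m p q \<cdot> induced C p q (m p q \<cdot> t) (q \<cdot> u) = m p q \<cdot> induced C p q (p \<cdot> t) (m p q \<cdot> u)"
      by blast
  qed (fact graph pb dcpq)+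
  moreover have "m p q \<cdot> induced C p q (\<one> C1) i = e \<cdot> d" "m p q \<cdot> induced C p q i (\<one> C1) = e \<cdot> c"
    using inv_right inv_left g i by (simp_all add: mgen(4))
  moreover have "i \<in> hom C C1 C1" using i by (simp add: mem_hom_iff)
  ultimately show ?thesis
    unfolding is_groupoid_def internal_groupoid_def using i(4,5) by blast
qed

end

section \<open>Kernel pairs\<close>

context category
begin

lemma pullback_flip:
  assumes pb: "is_pullback C f g P p q"
  shows "is_pullback C g f P q p"
  unfolding is_pullback_def mem_hom_iff
proof (intro conjI allI impI; (elim conjE)?)
  fix Z x y
  assume xy: "x \<in> Arr C" "Dom C x = Z" "Cod C x = Dom C g" "y \<in> Arr C" "Dom C y = Z"
    "Cod C y = Dom C f" "g \<cdot> x = f \<cdot> y"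
  have "\<exists>!h. h \<in> hom C (Dom C y) P \<and> p \<cdot> h = y \<and> q \<cdot> h = x"
    by (rule pullback_universal[OF pb]) (use xy in simp_all)
  then show "\<exists>!h. (h \<in> Arr C \<and> Dom C h = Z \<and> Cod C h = P) \<and> q \<cdot> h = x \<and> p \<cdot> h = y"
    using xy(5) by (simp add: mem_hom_iff conj_commute)
qed (use pullback_cospan[OF pb] pullback_typing[OF pb] pullback_square[OF pb] in simp_all)

lemma kernel_pair_diagonal:
  assumes "is_pullback C f f R r0 r1"
  defines "\<Delta> \<equiv> induced C r0 r1 (\<one> (Dom C f)) (\<one> (Dom C f))"
  shows "\<Delta> \<in> Arr C" "Dom C \<Delta> = Dom C f" "Cod C \<Delta> = R" "r0 \<cdot> \<Delta> = \<one> (Dom C f)"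
    "r1 \<cdot> \<Delta> = \<one> (Dom C f)"
  unfolding \<Delta>_def
  using induced_props[OF assms(1), of "\<one> (Dom C f)" "\<one> (Dom C f)"] pullback_cospan(1)[OF assms(1)]
  by simp_all

lemma kernel_pair_symmetry:
  assumes pb: "is_pullback C f f R r0 r1"
  defines "\<sigma> \<equiv> induced C r0 r1 r1 r0"
  shows "\<sigma> \<in> Arr C" "Dom C \<sigma> = R" "Cod C \<sigma> = R" "r0 \<cdot> \<sigma> = r1" "r1 \<cdot> \<sigma> = r0"
  unfolding \<sigma>_def
  using induced_props[OF pb, of r1 r0] pullback_typing[OF pb] pullback_square[OF pb] by simp_all

end

context pointed_protomodular_category
begin

lemma effective_kernel_pair:
  assumes pb: "is_pullback C f f R r0 r1"
  shows "effective_equivalence_relation C (Dom C f) R r0 r1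
    (induced C r0 r1 (\<one> (Dom C f)) (\<one> (Dom C f)))"
proof -
  note f = pullback_cospan(1)[OF pb] and r = pullback_typing[OF pb] and sq = pullback_square[OF pb]
  note \<Delta> = kernel_pair_diagonal[OF pb] and \<sigma> = kernel_pair_symmetry[OF pb]
  have "\<exists>P p q. is_pullback C r1 r0 P p q"
    using r by (simp add: pullback_exists finitely_complete)
  then obtain P p q where P: "is_pullback C r1 r0 P p q" by blast
  note pq = pullback_typing[OF P, unfolded r] and sq' = pullback_square[OF P]
  have "f \<cdot> (r0 \<cdot> p) = f \<cdot> (r1 \<cdot> q)"
    using comp_eq_extend[OF sq, of p] comp_eq_extend[OF sq, of q] sq' f r pq by simp
  then have "\<exists>\<tau> \<in> hom C P R. r0 \<cdot> \<tau> = r0 \<cdot> p \<and> r1 \<cdot> \<tau> = r1 \<cdot> q"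
    using induced_props[OF pb, of "r0 \<cdot> p" "r1 \<cdot> q"] r pq
    by (intro bexI[of _ "induced C r0 r1 (r0 \<cdot> p) (r1 \<cdot> q)"]) (simp_all add: mem_hom_iff)
  with P have trans: "\<exists>P p q. is_pullback C r1 r0 P p q \<and>
      (\<exists>\<tau> \<in> hom C P R. r0 \<cdot> \<tau> = r0 \<cdot> p \<and> r1 \<cdot> \<tau> = r1 \<cdot> q)" by blast
  have sym: "\<exists>\<sigma> \<in> hom C R R. r0 \<cdot> \<sigma> = r1 \<and> r1 \<cdot> \<sigma> = r0"
    using \<sigma> by (intro bexI) (auto simp: mem_hom_iff)
  have mono: "\<forall>Z. \<forall>x \<in> hom C Z R. \<forall>y \<in> hom C Z R. r0 \<cdot> x = r0 \<cdot> y \<and> r1 \<cdot> x = r1 \<cdot> y \<longrightarrow> x = y"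
  proof (intro allI ballI impI)
    fix Z x y assume "x \<in> hom C Z R" "y \<in> hom C Z R" "r0 \<cdot> x = r0 \<cdot> y \<and> r1 \<cdot> x = r1 \<cdot> y"
    then show "x = y" unfolding mem_hom_iff by - (rule pullback_eqI[OF pb]; simp)
  qed
  have "equivalence_relation C (Dom C f) R r0 r1 (induced C r0 r1 (\<one> (Dom C f)) (\<one> (Dom C f)))"
    unfolding equivalence_relation_def
    using trans sym mono f r \<Delta> by (auto simp: mem_hom_iff)
  then show ?thesis unfolding effective_equivalence_relation_def using f pb by blast
qed

text \<open>A kernel of \<open>r0\<close> consists of the pairs \<open>(0, x)\<close> with \<open>f x = 0\<close>. Choosing it in this way makes the
  normalisation equal to the given kernel of \<open>f\<close>, and not merely isomorphic to it.\<close>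

lemma kernel_of_kernel_pair_projection:
  assumes pb: "is_pullback C f f R r0 r1" and ker: "is_kernel C f k"
  defines "j \<equiv> induced C r0 r1 (zero_mor C (Dom C k) (Dom C f)) k"
  shows "is_kernel C r0 j" "r1 \<cdot> j = k"
proof -
  note f = pullback_cospan(1)[OF pb] and r = pullback_typing[OF pb] and sq = pullback_square[OF pb]
  note k = kernel_typing(2-)[OF ker]
  have j: "j \<in> Arr C" "Dom C j = Dom C k" "Cod C j = R" "r0 \<cdot> j = zero_mor C (Dom C k) (Dom C f)"
    "r1 \<cdot> j = k"
    unfolding j_def using induced_props[OF pb, of "zero_mor C (Dom C k) (Dom C f)" k] f k by simp_all
  note ext = comp_eq_extend[OF j(4)] comp_eq_extend[OF j(5)]
  show "r1 \<cdot> j = k" by (rule j(5))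
  show "is_kernel C r0 j"
  proof (rule is_kernelI)
    fix x assume x: "x \<in> Arr C" "Cod C x = Dom C r0" "r0 \<cdot> x = zero_mor C (Dom C x) (Cod C r0)"
    have "f \<cdot> (r1 \<cdot> x) = zero_mor C (Dom C (r1 \<cdot> x)) (Cod C f)"
      using comp_eq_extend[OF sq, of x] x f r by simp
    then obtain h where h: "h \<in> Arr C" "Dom C h = Dom C x" "Cod C h = Dom C k" "k \<cdot> h = r1 \<cdot> x"
      using kernel_lift[OF ker, of "r1 \<cdot> x"] x(1,2) r f by (metis comp_typing)
    have "j \<cdot> h = x"
      by (rule pullback_eqI[OF pb]) (use x h j k r f ext in simp_all)
    with h j show "\<exists>h. h \<in> Arr C \<and> Dom C h = Dom C x \<and> Cod C h = Dom C j \<and> j \<cdot> h = x" by auto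
  next
    fix h h' assume h: "h \<in> Arr C" "h' \<in> Arr C" "Dom C h = Dom C h'" "Cod C h = Dom C j"
      "Cod C h' = Dom C j" "j \<cdot> h = j \<cdot> h'"
    have "r1 \<cdot> (j \<cdot> h) = r1 \<cdot> (j \<cdot> h')" by (simp only: h(6))
    then have "k \<cdot> h = k \<cdot> h'" using h(1,2,4,5) j r by (simp add: ext)
    then show "h = h'" using h(1-5) j by - (rule kernel_cancel[OF ker]; simp)
  qed (use j r f in simp_all)
qed

lemma normalisation_of_kernel_pair:
  assumes pb: "is_pullback C f f R r0 r1" and ker: "is_kernel C r0 j"
  shows "is_kernel C f (r1 \<cdot> j)"
proof -
  note f = pullback_cospan(1)[OF pb] and r = pullback_typing[OF pb] and sq = pullback_square[OF pb]
  note j = kernel_typing(2-)[OF ker, unfolded r]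
  note ext = comp_eq_extend[OF j(3)] comp_eq_extend[OF sq[symmetric]]
  show ?thesis
  proof (rule is_kernelI)
    fix x assume x: "x \<in> Arr C" "Cod C x = Dom C f" "f \<cdot> x = zero_mor C (Dom C x) (Cod C f)"
    define y where "y = induced C r0 r1 (zero_mor C (Dom C x) (Dom C f)) x"
    have y: "y \<in> Arr C" "Dom C y = Dom C x" "Cod C y = R" "r0 \<cdot> y = zero_mor C (Dom C x) (Dom C f)"
      "r1 \<cdot> y = x"
      unfolding y_def using induced_props[OF pb, of "zero_mor C (Dom C x) (Dom C f)" x] f x by simp_all
    obtain h where h: "h \<in> Arr C" "Dom C h = Dom C x" "Cod C h = Dom C j" "j \<cdot> h = y"
      using kernel_lift[OF ker, of y] y r by metis
    have "(r1 \<cdot> j) \<cdot> h = x" using h y j r by simp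
    with h j r show "\<exists>h. h \<in> Arr C \<and> Dom C h = Dom C x \<and> Cod C h = Dom C (r1 \<cdot> j) \<and> (r1 \<cdot> j) \<cdot> h = x"
      by (intro exI[of _ h]) simp
  next
    fix h h' assume h: "h \<in> Arr C" "h' \<in> Arr C" "Dom C h = Dom C h'" "Cod C h = Dom C (r1 \<cdot> j)"
      "Cod C h' = Dom C (r1 \<cdot> j)" "(r1 \<cdot> j) \<cdot> h = (r1 \<cdot> j) \<cdot> h'"
    have hj: "Cod C h = Dom C j" "Cod C h' = Dom C j" using h(4,5) j r by simp_all
    have "r1 \<cdot> (j \<cdot> h) = r1 \<cdot> (j \<cdot> h')" using h(6,1,2) hj j r by simp
    then have "j \<cdot> h = j \<cdot> h'"
      using h(1-3) hj j r f by - (rule pullback_eqI[OF pb]; simp add: ext)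
    then show "h = h'" using h(1-3) hj by - (rule kernel_cancel[OF ker]; simp)
  qed (use j r f ext in simp_all)
qed

end

section \<open>From a connector to a groupoid\<close>

text \<open>With the reflexivity morphisms as parameters, the locale is stable under exchanging the two kernel
  pairs and reversing each of them: a morphism \<open>induced C r0 r1 (\<one> A) (\<one> A)\<close> would turn into
  \<open>induced C r1 r0 (\<one> A) (\<one> A)\<close>, which is equal to it, but not by definition.\<close>

locale two_kernel_pairs = pointed_protomodular_category +
  fixes A R r0 r1 \<Delta>R S s0 s1 \<Delta>S f g
  assumes R: "is_pullback C f f R r0 r1" and S: "is_pullback C g g S s0 s1"
    and dom_f: "Dom C f = A" and dom_g: "Dom C g = A"
    and \<Delta>R: "\<Delta>R \<in> Arr C" "Dom C \<Delta>R = A" "Cod C \<Delta>R = R" "r0 \<cdot> \<Delta>R = \<one> A" "r1 \<cdot> \<Delta>R = \<one> A"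
    and \<Delta>S: "\<Delta>S \<in> Arr C" "Dom C \<Delta>S = A" "Cod C \<Delta>S = S" "s0 \<cdot> \<Delta>S = \<one> A" "s1 \<cdot> \<Delta>S = \<one> A"
begin

lemmas f_typing = pullback_cospan(1)[OF R] dom_f
lemmas g_typing = pullback_cospan(1)[OF S] dom_g
lemmas r_typing = pullback_typing[OF R, unfolded dom_f]
lemmas s_typing = pullback_typing[OF S, unfolded dom_g]
lemmas \<Delta>_extend = comp_eq_extend[OF \<Delta>R(4)] comp_eq_extend[OF \<Delta>R(5)]
  comp_eq_extend[OF \<Delta>S(4)] comp_eq_extend[OF \<Delta>S(5)]
lemmas R_pair = induced_props[OF R, unfolded dom_f]
lemmas S_pair = induced_props[OF S, unfolded dom_g]
lemmas R_pair_comp = induced_comp[OF R, unfolded dom_f]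
lemmas S_pair_comp = induced_comp[OF S, unfolded dom_g]

lemma r_square: "\<lbrakk>x \<in> Arr C; Cod C x = R\<rbrakk> \<Longrightarrow> f \<cdot> (r0 \<cdot> x) = f \<cdot> (r1 \<cdot> x)"
  using comp_eq_extend[OF pullback_square[OF R], of x] f_typing r_typing by simp

lemma s_square: "\<lbrakk>x \<in> Arr C; Cod C x = S\<rbrakk> \<Longrightarrow> g \<cdot> (s0 \<cdot> x) = g \<cdot> (s1 \<cdot> x)"
  using comp_eq_extend[OF pullback_square[OF S], of x] g_typing s_typing by simp

lemma R_diagonal: "\<lbrakk>x \<in> Arr C; Cod C x = A\<rbrakk> \<Longrightarrow> induced C r0 r1 x x = \<Delta>R \<cdot> x"
  by (rule induced_eqI[OF R]) (use \<Delta>R \<Delta>_extend r_typing in simp_all)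

lemma S_diagonal: "\<lbrakk>x \<in> Arr C; Cod C x = A\<rbrakk> \<Longrightarrow> induced C s0 s1 x x = \<Delta>S \<cdot> x"
  by (rule induced_eqI[OF S]) (use \<Delta>S \<Delta>_extend s_typing in simp_all)

end

locale connector = two_kernel_pairs +
  fixes T
  assumes T: "fibred_operation C r1 s0 A T"
    and T_left: "\<lbrakk>x \<in> Arr C; Cod C x = R\<rbrakk> \<Longrightarrow> T x (\<Delta>S \<cdot> (r1 \<cdot> x)) = r0 \<cdot> x"
    and T_right: "\<lbrakk>y \<in> Arr C; Cod C y = S\<rbrakk> \<Longrightarrow> T (\<Delta>R \<cdot> (s0 \<cdot> y)) y = s1 \<cdot> y"
begin

text \<open>The connector on elements \<open>x R y S z\<close>, to be read as \<open>x y\<^sup>-\<^sup>1 z\<close>.\<close>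

definition \<theta> where "\<theta> x y z = T (induced C r0 r1 x y) (induced C s0 s1 y z)"

lemmas T_typing = fibred_operation_typing[OF T, unfolded r_typing s_typing]
lemmas T_comp = fibred_operation_comp[OF T, unfolded r_typing s_typing]

text \<open>Reading \<open>x y\<^sup>-\<^sup>1 z\<close> from right to left exchanges the two relations; so each law for \<open>f\<close> has a
  mirror image for \<open>g\<close>, which needs no second proof.\<close>

lemma connector_flip: "connector C A S s1 s0 \<Delta>S R r1 r0 \<Delta>R g f (\<lambda>y x. T x y)"
proof unfold_locales
  show "fibred_operation C s0 r1 A (\<lambda>y x. T x y)"
    by (rule fibred_operationI) (use r_typing s_typing in \<open>simp_all add: T_typing T_comp\<close>)
qed (use pullback_flip[OF R] pullback_flip[OF S] dom_f dom_g \<Delta>R \<Delta>S T_left T_right in simp_all)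

text \<open>On \<open>(x, y, y)\<close> both sides are \<open>f x = f y\<close>, and on \<open>(y, y, z)\<close> both are \<open>f z\<close>.\<close>

lemma f_T:
  assumes "x \<in> Arr C" "y \<in> Arr C" "Dom C x = Dom C y" "Cod C x = R" "Cod C y = S" "r1 \<cdot> x = s0 \<cdot> y"
  shows "f \<cdot> T x y = f \<cdot> (s1 \<cdot> y)"
proof -
  have 1: "fibred_operation C r1 s0 (Cod C f) (\<lambda>x y. f \<cdot> T x y)"
    by (rule fibred_operationI) (use f_typing r_typing s_typing in \<open>simp_all add: T_typing T_comp\<close>)
  have 2: "fibred_operation C r1 s0 (Cod C f) (\<lambda>x y. f \<cdot> (s1 \<cdot> y))"
    by (rule fibred_operationI) (use f_typing r_typing s_typing in simp_all)
  show ?thesis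
    by (rule fibred_operation_eqI[OF 1 2, of \<Delta>R \<Delta>S])
      (use assms f_typing r_typing s_typing \<Delta>R \<Delta>S \<Delta>_extend in
        \<open>simp_all add: T_left T_right r_square\<close>)
qed

text \<open>This is \<open>(x y\<^sup>-\<^sup>1 z) z\<^sup>-\<^sup>1 z' = x y\<^sup>-\<^sup>1 z'\<close>. Each side is an operation on an element \<open>(x, y)\<close> of \<open>R\<close> and an
  element \<open>(y, z, z')\<close> of the pullback of \<open>s0\<close> with itself. For \<open>z = z' = y\<close> both sides are \<open>x\<close>, and for
  \<open>x = y\<close> both are \<open>z'\<close>.\<close>

lemma T_absorb:
  assumes "x \<in> Arr C" "y \<in> Arr C" "y' \<in> Arr C" "Dom C x = Dom C y'" "Dom C y = Dom C y'"
    "Cod C x = R" "Cod C y = S" "Cod C y' = S" "r1 \<cdot> x = s0 \<cdot> y" "s0 \<cdot> y = s0 \<cdot> y'"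
  shows "T (induced C r0 r1 (T x y) (s1 \<cdot> y)) (induced C s0 s1 (s1 \<cdot> y) (s1 \<cdot> y')) = T x y'"
proof -
  obtain Q u v where Q: "is_pullback C s0 s0 Q u v"
    using pullback_exists[OF finitely_complete, of s0 s0] s_typing by blast
  note uv = pullback_typing[OF Q, unfolded s_typing] and sqQ = pullback_square[OF Q]
  have Q_elem: "s0 \<cdot> (v \<cdot> w) = s0 \<cdot> (u \<cdot> w)" if "w \<in> Arr C" "Cod C w = Q" for w
    using comp_eq_extend[OF sqQ, of w] that uv s_typing by simp
  have g_elem: "g \<cdot> (s1 \<cdot> (u \<cdot> w)) = g \<cdot> (s1 \<cdot> (v \<cdot> w))" if w: "w \<in> Arr C" "Cod C w = Q" for w
    using s_square[of "u \<cdot> w"] s_square[of "v \<cdot> w"] Q_elem[OF w] w uv by simp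
  define D where "D = induced C u v \<Delta>S \<Delta>S"
  have D: "D \<in> Arr C" "Dom C D = A" "Cod C D = Q" "u \<cdot> D = \<Delta>S" "v \<cdot> D = \<Delta>S"
    using induced_props[OF Q, of \<Delta>S \<Delta>S] \<Delta>S s_typing by (simp_all add: D_def)
  note D_ext = comp_eq_extend[OF D(4)] comp_eq_extend[OF D(5)]
  define F where "F x w = T (induced C r0 r1 (T x (u \<cdot> w)) (s1 \<cdot> (u \<cdot> w)))
    (induced C s0 s1 (s1 \<cdot> (u \<cdot> w)) (s1 \<cdot> (v \<cdot> w)))" for x w
  define G where "G x w = T x (v \<cdot> w)" for x w
  note simps = T_typing T_comp f_T R_pair S_pair R_pair_comp S_pair_comp Q_elem g_elem
  have F: "fibred_operation C r1 (s0 \<cdot> u) A F"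
    unfolding F_def by (rule fibred_operationI) (use r_typing s_typing uv in \<open>simp_all add: simps\<close>)
  have G: "fibred_operation C r1 (s0 \<cdot> u) A G"
    unfolding G_def by (rule fibred_operationI) (use r_typing s_typing uv in \<open>simp_all add: simps\<close>)
  have FG: "F x w = G x w"
    if xw: "x \<in> Arr C" "w \<in> Arr C" "Dom C x = Dom C w" "Cod C x = R" "Cod C w = Q"
      "r1 \<cdot> x = (s0 \<cdot> u) \<cdot> w" for x w
  proof (rule fibred_operation_eqI[OF F G, of \<Delta>R D])
    fix x assume x: "x \<in> Arr C" "Cod C x = Dom C r1"
    have "induced C r0 r1 (r0 \<cdot> x) (r1 \<cdot> x) = x"
      by (rule induced_eqI[OF R]) (use x r_typing in simp_all)
    then show "F x (D \<cdot> (r1 \<cdot> x)) = G x (D \<cdot> (r1 \<cdot> x))"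
      unfolding F_def G_def using x r_typing s_typing D \<Delta>S \<Delta>_extend D_ext uv
      by (simp add: T_left S_diagonal)
  next
    fix w assume w: "w \<in> Arr C" "Cod C w = Dom C (s0 \<cdot> u)"
    then have w': "Cod C w = Q" using uv s_typing by simp
    have "T (\<Delta>R \<cdot> (s0 \<cdot> (v \<cdot> w))) (v \<cdot> w) = s1 \<cdot> (v \<cdot> w)"
      by (rule T_right) (use w w' uv in simp_all)
    then have v: "T (\<Delta>R \<cdot> (s0 \<cdot> (u \<cdot> w))) (v \<cdot> w) = s1 \<cdot> (v \<cdot> w)"
      by (simp only: Q_elem[OF w(1) w'])
    define b where "b = induced C s0 s1 (s1 \<cdot> (u \<cdot> w)) (s1 \<cdot> (v \<cdot> w))"
    have b: "b \<in> Arr C" "Cod C b = S" "s0 \<cdot> b = s1 \<cdot> (u \<cdot> w)" "s1 \<cdot> b = s1 \<cdot> (v \<cdot> w)"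
      using w w' uv s_typing by (simp_all add: b_def simps)
    have "T (\<Delta>R \<cdot> (s0 \<cdot> b)) b = s1 \<cdot> b" by (rule T_right[OF b(1,2)])
    then have "T (\<Delta>R \<cdot> (s1 \<cdot> (u \<cdot> w))) b = s1 \<cdot> (v \<cdot> w)" by (simp only: b(3,4))
    then show "F (\<Delta>R \<cdot> ((s0 \<cdot> u) \<cdot> w)) w = G (\<Delta>R \<cdot> ((s0 \<cdot> u) \<cdot> w)) w"
      unfolding F_def G_def using v w w' uv s_typing by (simp add: T_right R_diagonal b_def)
  qed (use xw r_typing s_typing uv D \<Delta>R \<Delta>S \<Delta>_extend in simp_all)
  define w where "w = induced C u v y y'"
  have w: "w \<in> Arr C" "Dom C w = Dom C y'" "Cod C w = Q" "u \<cdot> w = y" "v \<cdot> w = y'"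
    using induced_props[OF Q, of y y'] assms s_typing by (simp_all add: w_def)
  have "F x w = G x w" by (rule FG) (use assms w uv s_typing in simp_all)
  then show ?thesis by (simp only: F_def G_def w)
qed

context
  fixes x y z
  assumes xyz: "x \<in> Arr C" "y \<in> Arr C" "z \<in> Arr C" "Dom C x = Dom C z" "Dom C y = Dom C z"
    "Cod C x = A" "Cod C y = A" "Cod C z = A" "f \<cdot> x = f \<cdot> y" "g \<cdot> y = g \<cdot> z"
begin

lemma \<theta>_typing: "\<theta> x y z \<in> Arr C" "Dom C (\<theta> x y z) = Dom C z" "Cod C (\<theta> x y z) = A"
  unfolding \<theta>_def using xyz by (simp_all add: T_typing R_pair S_pair)

lemma \<theta>_comp:
  assumes w: "w \<in> Arr C" "Cod C w = Dom C z"
  shows "\<theta> x y z \<cdot> w = \<theta> (x \<cdot> w) (y \<cdot> w) (z \<cdot> w)"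
  unfolding \<theta>_def using xyz w by (simp add: T_comp R_pair S_pair R_pair_comp S_pair_comp)

lemma f_\<theta>: "f \<cdot> \<theta> x y z = f \<cdot> z"
  unfolding \<theta>_def using xyz by (simp add: f_T R_pair S_pair)

lemma \<theta>_absorb:
  assumes z': "z' \<in> Arr C" "Dom C z' = Dom C z" "Cod C z' = A" "g \<cdot> z' = g \<cdot> z"
  shows "\<theta> (\<theta> x y z) z z' = \<theta> x y z'"
proof -
  note i = R_pair[OF xyz(1,6,2,7) _ xyz(9)] S_pair[OF xyz(2,7,3,8,5,10)] S_pair[of y z']
  have "T (induced C r0 r1 (T (induced C r0 r1 x y) (induced C s0 s1 y z)) (s1 \<cdot> induced C s0 s1 y z))
      (induced C s0 s1 (s1 \<cdot> induced C s0 s1 y z) (s1 \<cdot> induced C s0 s1 y z')) =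
      T (induced C r0 r1 x y) (induced C s0 s1 y z')"
    by (rule T_absorb) (use xyz z' i in simp_all)
  then show ?thesis unfolding \<theta>_def using xyz z' i by simp
qed

end

lemma \<theta>_left:
  assumes "x \<in> Arr C" "y \<in> Arr C" "Dom C x = Dom C y" "Cod C x = A" "Cod C y = A" "f \<cdot> x = f \<cdot> y"
  shows "\<theta> x y y = x"
  using T_left[of "induced C r0 r1 x y"] R_pair[OF assms(1,4,2,5,3,6)] assms
  unfolding \<theta>_def by (simp add: S_diagonal)

lemma \<theta>_right:
  assumes "y \<in> Arr C" "z \<in> Arr C" "Dom C y = Dom C z" "Cod C y = A" "Cod C z = A" "g \<cdot> y = g \<cdot> z"
  shows "\<theta> y y z = z"
  using T_right[of "induced C s0 s1 y z"] S_pair[OF assms(1,4,2,5,3,6)] assms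
  unfolding \<theta>_def by (simp add: R_diagonal)

interpretation flip: connector C A S s1 s0 \<Delta>S R r1 r0 \<Delta>R g f "\<lambda>y x. T x y"
  by (rule connector_flip)

lemma flip_\<theta>:
  assumes "x \<in> Arr C" "y \<in> Arr C" "z \<in> Arr C" "Dom C x = Dom C z" "Dom C y = Dom C z"
    "Cod C x = A" "Cod C y = A" "Cod C z = A" "f \<cdot> x = f \<cdot> y" "g \<cdot> y = g \<cdot> z"
  shows "flip.\<theta> z y x = \<theta> x y z"
proof -
  have "induced C r1 r0 y x = induced C r0 r1 x y"
    by (rule induced_eqI[OF pullback_flip[OF R]]) (use assms in \<open>simp_all add: R_pair\<close>)
  moreover have "induced C s1 s0 z y = induced C s0 s1 y z"
    by (rule induced_eqI[OF pullback_flip[OF S]]) (use assms in \<open>simp_all add: S_pair\<close>)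
  ultimately show ?thesis unfolding \<theta>_def flip.\<theta>_def by simp
qed

lemma g_\<theta>:
  assumes "x \<in> Arr C" "y \<in> Arr C" "z \<in> Arr C" "Dom C x = Dom C z" "Dom C y = Dom C z"
    "Cod C x = A" "Cod C y = A" "Cod C z = A" "f \<cdot> x = f \<cdot> y" "g \<cdot> y = g \<cdot> z"
  shows "g \<cdot> \<theta> x y z = g \<cdot> x"
  using flip.f_\<theta>[of z y x] flip_\<theta>[OF assms] assms by simp

lemma \<theta>_absorb':
  assumes "w \<in> Arr C" "x \<in> Arr C" "y \<in> Arr C" "z \<in> Arr C"
    "Dom C w = Dom C z" "Dom C x = Dom C z" "Dom C y = Dom C z"
    "Cod C w = A" "Cod C x = A" "Cod C y = A" "Cod C z = A"
    "f \<cdot> w = f \<cdot> x" "f \<cdot> x = f \<cdot> y" "g \<cdot> y = g \<cdot> z"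
  shows "\<theta> w x (\<theta> x y z) = \<theta> w y z"
proof -
  have "flip.\<theta> (flip.\<theta> z y x) x w = flip.\<theta> z y w"
    by (rule flip.\<theta>_absorb) (use assms in simp_all)
  moreover have "flip.\<theta> z y x = \<theta> x y z" "flip.\<theta> z y w = \<theta> w y z"
    "flip.\<theta> (\<theta> x y z) x w = \<theta> w x (\<theta> x y z)"
    by (rule flip_\<theta>; use assms in \<open>simp add: \<theta>_typing g_\<theta>\<close>)+
  ultimately show ?thesis by simp
qed

end

context pointed_protomodular_category
begin

text \<open>The inverse of \<open>x\<close> is \<open>\<theta> (e d x, x, e c x)\<close>; the absorption laws, with the identity \<open>e c x\<close>
  or \<open>e d x\<close> as the absorbed element, give the two inverse laws.\<close>

lemma groupoid_of_connector:
  assumes graph: "reflexive_graph C C1 C0 d c e"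
    and conn: "connector C C1 R r0 r1 \<Delta>R S s0 s1 \<Delta>S d c T"
  shows "is_groupoid C C1 C0 d c e"
proof -
  interpret connector C C1 R r0 r1 \<Delta>R S s0 s1 \<Delta>S d c T by (rule conn)
  note g = reflexive_graph_typing[OF graph]
  note ext = comp_eq_extend[OF g(12)] comp_eq_extend[OF g(13)]
  note simps = \<theta>_typing \<theta>_comp f_\<theta> g_\<theta> ext
  show ?thesis
  proof (rule is_groupoidI[OF graph])
    show "fibred_operation C c d C1 (\<lambda>x y. \<theta> y (e \<cdot> (d \<cdot> y)) x)"
      by (rule fibred_operationI) (use g in \<open>simp_all add: simps\<close>)
    show "d \<cdot> \<theta> y (e \<cdot> (d \<cdot> y)) x = d \<cdot> x \<and> c \<cdot> \<theta> y (e \<cdot> (d \<cdot> y)) x = c \<cdot> y"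
      if "x \<in> Arr C" "y \<in> Arr C" "Dom C x = Dom C y" "Cod C x = C1" "Cod C y = C1" "c \<cdot> x = d \<cdot> y"
      for x y
      using that g by (simp add: simps)
    show "\<theta> x (e \<cdot> (d \<cdot> x)) (e \<cdot> (d \<cdot> x)) = x" if "x \<in> Arr C" "Cod C x = C1" for x
      by (rule \<theta>_left) (use that g ext in simp_all)
    show "\<theta> (e \<cdot> (c \<cdot> x)) (e \<cdot> (d \<cdot> (e \<cdot> (c \<cdot> x)))) x = x" if "x \<in> Arr C" "Cod C x = C1" for x
      using that g \<theta>_right[of "e \<cdot> (c \<cdot> x)" x] by (simp add: ext)
    let ?i = "\<theta> (e \<cdot> d) (\<one> C1) (e \<cdot> c)"
    show "?i \<in> Arr C" "Dom C ?i = C1" "Cod C ?i = C1" and di: "d \<cdot> ?i = c" and "c \<cdot> ?i = d"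
      using g by (simp_all add: simps)
    have "\<theta> ?i (e \<cdot> c) (\<one> C1) = \<theta> (e \<cdot> d) (\<one> C1) (\<one> C1)"
      by (rule \<theta>_absorb) (use g ext in simp_all)
    also have "\<dots> = e \<cdot> d" by (rule \<theta>_left) (use g ext in simp_all)
    finally show "\<theta> ?i (e \<cdot> (d \<cdot> ?i)) (\<one> C1) = e \<cdot> d" by (simp only: di)
    have "\<theta> (\<one> C1) (e \<cdot> d) ?i = \<theta> (\<one> C1) (\<one> C1) (e \<cdot> c)"
      by (rule \<theta>_absorb') (use g ext in simp_all)
    also have "\<dots> = e \<cdot> c" by (rule \<theta>_right) (use g ext in simp_all)
    finally show "\<theta> (\<one> C1) (e \<cdot> (d \<cdot> \<one> C1)) ?i = e \<cdot> c" using g by simp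
  qed
qed

lemma SH_imp_SH':
  assumes SH: "condition_SH C"
  shows "condition_SH' C"
  unfolding condition_SH'_def
proof (intro allI impI; elim conjE)
  fix C1 C0 d c e kerd kerc
  assume graph: "reflexive_graph C C1 C0 d c e" and kerd: "is_kernel C d kerd"
    and kerc: "is_kernel C c kerc" and huq: "huq_commute C kerd kerc"
  note g = reflexive_graph_typing[OF graph]
  obtain R r0 r1 where R: "is_pullback C d d R r0 r1"
    using pullback_exists[OF finitely_complete, of d d] g by blast
  obtain S s0 s1 where S: "is_pullback C c c S s0 s1"
    using pullback_exists[OF finitely_complete, of c c] g by blast
  let ?\<Delta>R = "induced C r0 r1 (\<one> C1) (\<one> C1)" and ?\<Delta>S = "induced C s0 s1 (\<one> C1) (\<one> C1)"
  note \<Delta>R = kernel_pair_diagonal[OF R, unfolded g] and \<Delta>S = kernel_pair_diagonal[OF S, unfolded g]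
  note r = pullback_typing[OF R, unfolded g] and s = pullback_typing[OF S, unfolded g]
  note jR = kernel_of_kernel_pair_projection[OF R kerd]
  note jS = kernel_of_kernel_pair_projection[OF S kerc]
  have "effective_equivalence_relation C C1 R r0 r1 ?\<Delta>R"
    "effective_equivalence_relation C C1 S s0 s1 ?\<Delta>S"
    using effective_kernel_pair[OF R] effective_kernel_pair[OF S] g by simp_all
  moreover have "huq_commute C (r1 \<cdot> induced C r0 r1 (zero_mor C (Dom C kerd) (Dom C d)) kerd)
      (s1 \<cdot> induced C s0 s1 (zero_mor C (Dom C kerc) (Dom C c)) kerc)"
    unfolding jR(2) jS(2) by (rule huq)
  ultimately have "smith_commute C C1 R r0 r1 ?\<Delta>R S s0 s1 ?\<Delta>S"
    using SH jR(1) jS(1) unfolding condition_SH_def by blast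
  then obtain T where T: "fibred_operation C r1 s0 C1 T"
    "\<And>x. \<lbrakk>x \<in> Arr C; Cod C x = R\<rbrakk> \<Longrightarrow> T x (?\<Delta>S \<cdot> (r1 \<cdot> x)) = r0 \<cdot> x"
    "\<And>y. \<lbrakk>y \<in> Arr C; Cod C y = S\<rbrakk> \<Longrightarrow> T (?\<Delta>R \<cdot> (s0 \<cdot> y)) y = s1 \<cdot> y"
    using smith_commuteE[of C1 R r0 r1 ?\<Delta>R S s0 s1 ?\<Delta>S] r s \<Delta>R \<Delta>S by blast
  have "connector C C1 R r0 r1 ?\<Delta>R S s0 s1 ?\<Delta>S d c T"
    by unfold_locales (use R S g \<Delta>R \<Delta>S T in simp_all)
  then show "is_groupoid C C1 C0 d c e" by (rule groupoid_of_connector[OF graph])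
qed

end

section \<open>The groupoid of triples\<close>

text \<open>A morphism of reflexive graphs from the kernel pair \<open>R\<close>, seen as a groupoid, preserves composition:
  \<open>J (x, y)\<close> followed by \<open>J (y, z)\<close> and \<open>J (x, z)\<close> agree when \<open>x = y\<close> or \<open>y = z\<close>. So it also preserves
  inverses, and the inverse of \<open>(x, y)\<close> in \<open>R\<close> is \<open>(y, x)\<close>.\<close>

lemma (in pointed_protomodular_category) inverse_of_kernel_pair_morphism:
  assumes gpd: "groupoid_elements C C1 A d c e m i"
    and R: "is_pullback C f f R r0 r1" and dom_f: "Dom C f = A"
    and \<Delta>: "\<Delta> \<in> Arr C" "Dom C \<Delta> = A" "Cod C \<Delta> = R" "r0 \<cdot> \<Delta> = \<one> A" "r1 \<cdot> \<Delta> = \<one> A"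
    and J: "J \<in> Arr C" "Dom C J = R" "Cod C J = C1" "d \<cdot> J = r0" "c \<cdot> J = r1" "J \<cdot> \<Delta> = e"
  shows "i \<cdot> J = J \<cdot> induced C r0 r1 r1 r0"
proof -
  interpret groupoid_elements C C1 A d c e m i by (rule gpd)
  note g = graph_typing
  note r = pullback_typing[OF R, unfolded dom_f] and sq = pullback_square[OF R]
  note f = pullback_cospan(1)[OF R]
  note \<sigma> = kernel_pair_symmetry[OF R]
  note mtyp = fibred_operation_typing[OF m, unfolded g] and mcomp = fibred_operation_comp[OF m, unfolded g]
  note ext = comp_eq_extend[OF J(4)] comp_eq_extend[OF J(5)] comp_eq_extend[OF J(6)]
    comp_eq_extend[OF \<Delta>(4)] comp_eq_extend[OF \<Delta>(5)]
  note pair = induced_props[OF R, unfolded dom_f] induced_comp[OF R, unfolded dom_f]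
  have sq': "f \<cdot> (r0 \<cdot> x) = f \<cdot> (r1 \<cdot> x)" if "x \<in> Arr C" "Cod C x = R" for x
    using comp_eq_extend[OF sq, of x] that f r dom_f by simp
  have fr: "f \<cdot> (r0 \<cdot> x) = f \<cdot> (r1 \<cdot> y)"
    if "x \<in> Arr C" "y \<in> Arr C" "Cod C x = R" "Cod C y = R" "r1 \<cdot> x = r0 \<cdot> y" for x y
    using sq'[OF that(1,3)] sq'[OF that(2,4)] that(5) by simp
  have F: "fibred_operation C r1 r0 C1 (\<lambda>x y. m (J \<cdot> x) (J \<cdot> y))"
    by (rule fibred_operationI) (use r J ext g in \<open>simp_all add: mtyp mcomp\<close>)
  have G: "fibred_operation C r1 r0 C1 (\<lambda>x y. J \<cdot> induced C r0 r1 (r0 \<cdot> x) (r1 \<cdot> y))"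
    by (rule fibred_operationI) (use r J fr in \<open>simp_all add: pair\<close>)
  have eta: "induced C r0 r1 (r0 \<cdot> x) (r1 \<cdot> x) = x" if "x \<in> Arr C" "Cod C x = R" for x
    by (rule induced_eqI[OF R]) (use that in simp_all)
  have "m (J \<cdot> x) (J \<cdot> y) = J \<cdot> induced C r0 r1 (r0 \<cdot> x) (r1 \<cdot> y)"
    if xy: "x \<in> Arr C" "y \<in> Arr C" "Dom C x = Dom C y" "Cod C x = R" "Cod C y = R" "r1 \<cdot> x = r0 \<cdot> y" for x y
  proof (rule fibred_operation_eqI[OF F G, of \<Delta> \<Delta>])
    fix x assume x: "x \<in> Arr C" "Cod C x = Dom C r1"
    then show "m (J \<cdot> x) (J \<cdot> (\<Delta> \<cdot> (r1 \<cdot> x))) =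
        J \<cdot> induced C r0 r1 (r0 \<cdot> x) (r1 \<cdot> (\<Delta> \<cdot> (r1 \<cdot> x)))"
      using unit_right[of "J \<cdot> x"] r J \<Delta> g ext eta by simp
  next
    fix y assume y: "y \<in> Arr C" "Cod C y = Dom C r0"
    then show "m (J \<cdot> (\<Delta> \<cdot> (r0 \<cdot> y))) (J \<cdot> y) =
        J \<cdot> induced C r0 r1 (r0 \<cdot> (\<Delta> \<cdot> (r0 \<cdot> y))) (r1 \<cdot> y)"
      using unit_left[of "J \<cdot> y"] r J \<Delta> g ext eta by simp
  qed (use xy r \<Delta> in simp_all)
  from this[of "\<one> R" "induced C r0 r1 r1 r0"]
  have "m J (J \<cdot> induced C r0 r1 r1 r0) = J \<cdot> induced C r0 r1 r0 r0"
    using r \<sigma> J by simp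
  also have "induced C r0 r1 r0 r0 = \<Delta> \<cdot> r0"
    by (rule induced_eqI[OF R]) (use r \<Delta> ext in simp_all)
  also have "J \<cdot> (\<Delta> \<cdot> r0) = e \<cdot> (d \<cdot> J)" using r \<Delta> J ext by simp
  finally show ?thesis
    using J \<sigma> r g ext by (intro inverse_unique) simp_all
qed

text \<open>\<open>P\<close> is the object of triples \<open>(x, y, z)\<close> with \<open>x R y S z\<close>; such a triple is an arrow from \<open>x\<close> to \<open>z\<close>.\<close>

locale kernel_pair_triples = two_kernel_pairs +
  fixes P p q
  assumes P: "is_pullback C r1 s0 P p q"
begin

definition triple where
  "triple x y z = induced C p q (induced C r0 r1 x y) (induced C s0 s1 y z)"

lemmas p_typing = pullback_typing[OF P, unfolded r_typing s_typing]
lemmas p_square = pullback_square[OF P]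
lemmas P_pair = induced_props[OF P, unfolded r_typing s_typing]

lemma p_square_elem: "\<lbrakk>x \<in> Arr C; Cod C x = P\<rbrakk> \<Longrightarrow> r1 \<cdot> (p \<cdot> x) = s0 \<cdot> (q \<cdot> x)"
  using comp_eq_extend[OF p_square, of x] r_typing s_typing p_typing by simp

lemma triple_eqI:
  assumes "t \<in> Arr C" "t' \<in> Arr C" "Dom C t = Dom C t'" "Cod C t = P" "Cod C t' = P"
    and "r0 \<cdot> (p \<cdot> t) = r0 \<cdot> (p \<cdot> t')" "s0 \<cdot> (q \<cdot> t) = s0 \<cdot> (q \<cdot> t')"
      "s1 \<cdot> (q \<cdot> t) = s1 \<cdot> (q \<cdot> t')"
  shows "t = t'"
proof (rule pullback_eqI[OF P])
  have "r1 \<cdot> (p \<cdot> t) = r1 \<cdot> (p \<cdot> t')" using assms by (simp add: p_square_elem)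
  then show "p \<cdot> t = p \<cdot> t'"
    using assms(1-6) p_typing by - (rule pullback_eqI[OF R]; simp)
  show "q \<cdot> t = q \<cdot> t'"
    using assms(1-5,7,8) p_typing by - (rule pullback_eqI[OF S]; simp)
qed (use assms in simp_all)

lemma triple_props:
  assumes "x \<in> Arr C" "y \<in> Arr C" "z \<in> Arr C" "Dom C x = Dom C z" "Dom C y = Dom C z"
    "Cod C x = A" "Cod C y = A" "Cod C z = A" "f \<cdot> x = f \<cdot> y" "g \<cdot> y = g \<cdot> z"
  shows "triple x y z \<in> Arr C" "Dom C (triple x y z) = Dom C z" "Cod C (triple x y z) = P"
    "r0 \<cdot> (p \<cdot> triple x y z) = x" "s0 \<cdot> (q \<cdot> triple x y z) = y" "s1 \<cdot> (q \<cdot> triple x y z) = z"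
  unfolding triple_def using assms by (simp_all add: P_pair R_pair S_pair)

lemma triple_comp:
  assumes "x \<in> Arr C" "y \<in> Arr C" "z \<in> Arr C" "Dom C x = Dom C z" "Dom C y = Dom C z"
    "Cod C x = A" "Cod C y = A" "Cod C z = A" "f \<cdot> x = f \<cdot> y" "g \<cdot> y = g \<cdot> z"
    and w: "w \<in> Arr C" "Cod C w = Dom C z"
  shows "triple x y z \<cdot> w = triple (x \<cdot> w) (y \<cdot> w) (z \<cdot> w)"
proof -
  note t = triple_props[OF assms(1-10)]
  note ext = comp_eq_extend[OF t(4)] comp_eq_extend[OF t(5)] comp_eq_extend[OF t(6)]
  have fg: "f \<cdot> (x \<cdot> w) = f \<cdot> (y \<cdot> w)" "g \<cdot> (y \<cdot> w) = g \<cdot> (z \<cdot> w)"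
    using comp_eq_extend[OF assms(9), of w] comp_eq_extend[OF assms(10), of w] assms f_typing g_typing
    by simp_all
  have u: "triple (x \<cdot> w) (y \<cdot> w) (z \<cdot> w) \<in> Arr C" "Dom C (triple (x \<cdot> w) (y \<cdot> w) (z \<cdot> w)) = Dom C w"
    "Cod C (triple (x \<cdot> w) (y \<cdot> w) (z \<cdot> w)) = P"
    "r0 \<cdot> (p \<cdot> triple (x \<cdot> w) (y \<cdot> w) (z \<cdot> w)) = x \<cdot> w"
    "s0 \<cdot> (q \<cdot> triple (x \<cdot> w) (y \<cdot> w) (z \<cdot> w)) = y \<cdot> w"
    "s1 \<cdot> (q \<cdot> triple (x \<cdot> w) (y \<cdot> w) (z \<cdot> w)) = z \<cdot> w"
    using triple_props[of "x \<cdot> w" "y \<cdot> w" "z \<cdot> w"] fg assms by simp_all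
  have v: "r0 \<cdot> (p \<cdot> (triple x y z \<cdot> w)) = x \<cdot> w" "s0 \<cdot> (q \<cdot> (triple x y z \<cdot> w)) = y \<cdot> w"
    "s1 \<cdot> (q \<cdot> (triple x y z \<cdot> w)) = z \<cdot> w"
    using comp_eq_extend[of "r0 \<cdot> p" "triple x y z" x w] comp_eq_extend[of "s0 \<cdot> q" "triple x y z" y w]
      comp_eq_extend[of "s1 \<cdot> q" "triple x y z" z w] t w r_typing s_typing p_typing by simp_all
  show ?thesis
    by (rule triple_eqI) (use t(1-3) u v w in simp_all)
qed

lemma triple_graph: "reflexive_graph C P A (r0 \<cdot> p) (s1 \<cdot> q) (induced C p q \<Delta>R \<Delta>S)"
  using r_typing s_typing p_typing \<Delta>R \<Delta>S P_pair[of \<Delta>R \<Delta>S] f_typing dom_in_obj[of f]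
  by (simp add: reflexive_graph_def mem_hom_iff)

text \<open>The operation is \<open>((0, y, z), (x, y', 0)) \<mapsto> (x, T (y, y'), z)\<close>, with \<open>T\<close> connecting the kernels of
  \<open>f\<close> and \<open>g\<close>. The value is again a triple because \<open>f T (y, y') = f y' = f x\<close> and
  \<open>g T (y, y') = g y = g z\<close>, by evaluation on \<open>(y, 0)\<close> and \<open>(0, y')\<close>.\<close>

lemma kernels_of_triple_graph_commute:
  assumes k: "is_kernel C f k" and l: "is_kernel C g l" and huq: "huq_commute C k l"
    and kd: "is_kernel C (r0 \<cdot> p) kd" and kc: "is_kernel C (s1 \<cdot> q) kc"
  shows "huq_commute C kd kc"
proof -
  obtain N where N: "zero_object C N" using pointed by blast
  then have NO: "N \<in> Obj C" unfolding zero_object_def by (rule conjunct1)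
  have idN: "zero_mor C N N = \<one> N" by (rule zero_object_eqI[OF N]) (use NO in simp_all)
  note k' = kernel_typing(2-)[OF k, unfolded dom_f] and l' = kernel_typing(2-)[OF l, unfolded dom_g]
  note tps = f_typing g_typing r_typing s_typing p_typing
  have kd': "kd \<in> Arr C" "Cod C kd = P" "r0 \<cdot> (p \<cdot> kd) = zero_mor C (Dom C kd) A"
    using kernel_typing[OF kd] tps by simp_all
  have kc': "kc \<in> Arr C" "Cod C kc = P" "s1 \<cdot> (q \<cdot> kc) = zero_mor C (Dom C kc) A"
    using kernel_typing[OF kc] tps by simp_all
  let ?X = "Dom C k" and ?Y = "Dom C l"
  have XY: "?X \<in> Obj C" "?Y \<in> Obj C" using k' l' by simp_all
  obtain T where T: "fibred_operation C (zero_mor C ?X N) (zero_mor C ?Y N) A T"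
    and T_left: "\<And>x. \<lbrakk>x \<in> Arr C; Cod C x = ?X\<rbrakk> \<Longrightarrow> T x (zero_mor C (Dom C x) ?Y) = k \<cdot> x"
    and T_right: "\<And>y. \<lbrakk>y \<in> Arr C; Cod C y = ?Y\<rbrakk> \<Longrightarrow> T (zero_mor C (Dom C y) ?X) y = l \<cdot> y"
    using huq_commuteE[OF huq N] l'(2) by metis
  have T_typing: "T x y \<in> Arr C" "Dom C (T x y) = Dom C y" "Cod C (T x y) = A"
    if "x \<in> Arr C" "y \<in> Arr C" "Dom C x = Dom C y" "Cod C x = ?X" "Cod C y = ?Y" for x y
    using fibred_operation_typing[OF T, of x y] that XY NO by simp_all
  have T_comp: "T x y \<cdot> w = T (x \<cdot> w) (y \<cdot> w)"
    if "x \<in> Arr C" "y \<in> Arr C" "Dom C x = Dom C y" "Cod C x = ?X" "Cod C y = ?Y"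
      "w \<in> Arr C" "Cod C w = Dom C y" for x y w
    using fibred_operation_comp[OF T, of x y w] that XY NO by simp
  note kl_ext = comp_eq_extend[OF k'(3)] comp_eq_extend[OF l'(3)]
  \<comment> \<open>On \<open>(x, 0)\<close> both sides vanish, as \<open>T\<close> is then \<open>k x\<close>; on \<open>(0, y)\<close> it is \<open>l y\<close>.\<close>
  have fT: "f \<cdot> T x y = f \<cdot> (l \<cdot> y)"
    if xy: "x \<in> Arr C" "y \<in> Arr C" "Dom C x = Dom C y" "Cod C x = ?X" "Cod C y = ?Y" for x y
  proof -
    have 1: "fibred_operation C (zero_mor C ?X N) (zero_mor C ?Y N) (Cod C f) (\<lambda>x y. f \<cdot> T x y)"
      by (rule fibred_operationI) (use tps XY NO in \<open>simp_all add: T_typing T_comp\<close>)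
    have 2: "fibred_operation C (zero_mor C ?X N) (zero_mor C ?Y N) (Cod C f) (\<lambda>x y. f \<cdot> (l \<cdot> y))"
      by (rule fibred_operationI) (use tps XY NO l' in simp_all)
    show ?thesis
      by (rule fibred_operation_eqI[OF 1 2, of "zero_mor C N ?X" "zero_mor C N ?Y"])
        (use xy tps XY NO k' l' kl_ext idN in \<open>simp_all add: T_left T_right\<close>)
  qed
  have gT: "g \<cdot> T x y = g \<cdot> (k \<cdot> x)"
    if xy: "x \<in> Arr C" "y \<in> Arr C" "Dom C x = Dom C y" "Cod C x = ?X" "Cod C y = ?Y" for x y
  proof -
    have 1: "fibred_operation C (zero_mor C ?X N) (zero_mor C ?Y N) (Cod C g) (\<lambda>x y. g \<cdot> T x y)"
      by (rule fibred_operationI) (use tps XY NO in \<open>simp_all add: T_typing T_comp\<close>)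
    have 2: "fibred_operation C (zero_mor C ?X N) (zero_mor C ?Y N) (Cod C g) (\<lambda>x y. g \<cdot> (k \<cdot> x))"
      by (rule fibred_operationI) (use tps XY NO k' in simp_all)
    show ?thesis
      by (rule fibred_operation_eqI[OF 1 2, of "zero_mor C N ?X" "zero_mor C N ?Y"])
        (use xy tps XY NO k' l' kl_ext idN in \<open>simp_all add: T_left T_right\<close>)
  qed
  \<comment> \<open>The middle entries of \<open>kd\<close> and \<open>kc\<close> lift to the kernels of \<open>f\<close> and \<open>g\<close>.\<close>
  have "f \<cdot> (s0 \<cdot> (q \<cdot> kd)) = f \<cdot> (r0 \<cdot> (p \<cdot> kd))"
    using r_square[of "p \<cdot> kd"] p_square_elem[of kd] kd'(1,2) tps by simp
  also have "\<dots> = zero_mor C (Dom C kd) (Cod C f)" using kd' tps by simp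
  finally have fkd: "f \<cdot> (s0 \<cdot> (q \<cdot> kd)) = zero_mor C (Dom C kd) (Cod C f)" .
  then obtain a where a: "a \<in> Arr C" "Dom C a = Dom C kd" "Cod C a = ?X" "k \<cdot> a = s0 \<cdot> (q \<cdot> kd)"
    using kernel_lift[OF k, of "s0 \<cdot> (q \<cdot> kd)"] kd'(1,2) tps by auto
  have "g \<cdot> (s0 \<cdot> (q \<cdot> kc)) = g \<cdot> (s1 \<cdot> (q \<cdot> kc))"
    using s_square[of "q \<cdot> kc"] kc'(1,2) tps by simp
  also have "\<dots> = zero_mor C (Dom C kc) (Cod C g)" using kc' tps by simp
  finally have gkc: "g \<cdot> (s0 \<cdot> (q \<cdot> kc)) = zero_mor C (Dom C kc) (Cod C g)" .
  then obtain b where b: "b \<in> Arr C" "Dom C b = Dom C kc" "Cod C b = ?Y" "l \<cdot> b = s0 \<cdot> (q \<cdot> kc)"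
    using kernel_lift[OF l, of "s0 \<cdot> (q \<cdot> kc)"] kc'(1,2) tps by auto
  define \<Phi> where "\<Phi> x y = triple (r0 \<cdot> (p \<cdot> (kc \<cdot> y))) (T (a \<cdot> x) (b \<cdot> y)) (s1 \<cdot> (q \<cdot> (kd \<cdot> x)))" for x y
  have fT': "f \<cdot> (r0 \<cdot> (p \<cdot> (kc \<cdot> y))) = f \<cdot> T (a \<cdot> x) (b \<cdot> y)"
    and gT': "g \<cdot> T (a \<cdot> x) (b \<cdot> y) = g \<cdot> (s1 \<cdot> (q \<cdot> (kd \<cdot> x)))"
    if xy: "x \<in> Arr C" "y \<in> Arr C" "Dom C x = Dom C y" "Cod C x = Dom C kd" "Cod C y = Dom C kc" for x y
  proof -
    have "f \<cdot> T (a \<cdot> x) (b \<cdot> y) = f \<cdot> (l \<cdot> (b \<cdot> y))" by (rule fT) (use xy a b in simp_all)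
    also have "l \<cdot> (b \<cdot> y) = s0 \<cdot> (q \<cdot> (kc \<cdot> y))"
      using comp_eq_extend[OF b(4), of y] xy b l' kc'(1,2) tps by simp
    also have "f \<cdot> \<dots> = f \<cdot> (r0 \<cdot> (p \<cdot> (kc \<cdot> y)))"
      using r_square[of "p \<cdot> (kc \<cdot> y)"] p_square_elem[of "kc \<cdot> y"] xy kc'(1,2) tps by simp
    finally show "f \<cdot> (r0 \<cdot> (p \<cdot> (kc \<cdot> y))) = f \<cdot> T (a \<cdot> x) (b \<cdot> y)" by simp
    have "g \<cdot> T (a \<cdot> x) (b \<cdot> y) = g \<cdot> (k \<cdot> (a \<cdot> x))" by (rule gT) (use xy a b in simp_all)
    also have "k \<cdot> (a \<cdot> x) = s0 \<cdot> (q \<cdot> (kd \<cdot> x))"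
      using comp_eq_extend[OF a(4), of x] xy a k' kd'(1,2) tps by simp
    also have "g \<cdot> \<dots> = g \<cdot> (s1 \<cdot> (q \<cdot> (kd \<cdot> x)))"
      using s_square[of "q \<cdot> (kd \<cdot> x)"] xy kd'(1,2) tps by simp
    finally show "g \<cdot> T (a \<cdot> x) (b \<cdot> y) = g \<cdot> (s1 \<cdot> (q \<cdot> (kd \<cdot> x)))" .
  qed
  note \<Phi>_simps = T_typing T_comp triple_props triple_comp fT' gT'
  have D: "Dom C kd \<in> Obj C" "Dom C kc \<in> Obj C" "A \<in> Obj C"
    using kd'(1) kc'(1) cod_in_obj[of r0] tps by simp_all
  show ?thesis
  proof (rule huq_commuteI[OF N])
    show "fibred_operation C (zero_mor C (Dom C kd) N) (zero_mor C (Dom C kc) N) (Cod C kc) \<Phi>"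
      unfolding \<Phi>_def
      by (rule fibred_operationI) (use tps NO D kd'(1,2) kc'(1,2) a(1-3) b(1-3) in \<open>simp_all add: \<Phi>_simps\<close>)
    let ?x = "\<one> (Dom C kd)" and ?y = "zero_mor C (Dom C kd) (Dom C kc)"
    have "\<Phi> ?x ?y = triple (zero_mor C (Dom C kd) A) (s0 \<cdot> (q \<cdot> kd)) (s1 \<cdot> (q \<cdot> kd))"
      unfolding \<Phi>_def using T_left[of a] tps D kd'(1,2) kc'(1,2) a b(1-3) k' XY by simp
    also have "\<dots> = kd"
    proof -
      have "g \<cdot> (s0 \<cdot> (q \<cdot> kd)) = g \<cdot> (s1 \<cdot> (q \<cdot> kd))"
        using s_square[of "q \<cdot> kd"] kd'(1,2) tps by simp
      then show ?thesis
        using fkd kd' tps D by - (rule triple_eqI; simp add: triple_props)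
    qed
    finally show "\<Phi> ?x ?y = kd" .
    let ?x = "zero_mor C (Dom C kc) (Dom C kd)" and ?y = "\<one> (Dom C kc)"
    have "\<Phi> ?x ?y = triple (r0 \<cdot> (p \<cdot> kc)) (s0 \<cdot> (q \<cdot> kc)) (zero_mor C (Dom C kc) A)"
      unfolding \<Phi>_def using T_right[of b] tps D kd'(1,2) kc'(1,2) a(1-3) b l' XY by simp
    also have "\<dots> = kc"
    proof -
      have "f \<cdot> (r0 \<cdot> (p \<cdot> kc)) = f \<cdot> (s0 \<cdot> (q \<cdot> kc))"
        using r_square[of "p \<cdot> kc"] p_square_elem[of kc] kc'(1,2) tps by simp
      then show ?thesis
        using gkc kc' tps D by - (rule triple_eqI; simp add: triple_props)
    qed
    finally show "\<Phi> ?x ?y = kc" .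
  qed (use kd' kc' in simp_all)
qed

text \<open>The connector is the middle entry of the inverse. The morphisms \<open>J\<close> and \<open>K\<close> embed \<open>R\<close> as the triples
  \<open>(x, y, y)\<close> and \<open>S\<close> as the triples \<open>(y, y, z)\<close>. Their inverses are \<open>(y, x, x)\<close> and \<open>(z, z, y)\<close>, with
  middle entries \<open>x\<close> and \<open>z\<close>.\<close>

lemma smith_commute_of_groupoid:
  assumes gpd: "is_groupoid C P A (r0 \<cdot> p) (s1 \<cdot> q) (induced C p q \<Delta>R \<Delta>S)"
  shows "smith_commute C A R r0 r1 \<Delta>R S s0 s1 \<Delta>S"
proof -
  obtain m i where ge: "groupoid_elements C P A (r0 \<cdot> p) (s1 \<cdot> q) (induced C p q \<Delta>R \<Delta>S) m i"
    using is_groupoidE[OF gpd] .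
  then interpret gpd: groupoid_elements C P A "r0 \<cdot> p" "s1 \<cdot> q" "induced C p q \<Delta>R \<Delta>S" m i .
  note tps = f_typing g_typing r_typing s_typing p_typing
  note i = gpd.i(1-3)
  have AO: "A \<in> Obj C" using f_typing dom_in_obj[of f] by simp
  have u: "s0 \<cdot> (q \<cdot> i) \<in> Arr C" "Dom C (s0 \<cdot> (q \<cdot> i)) = P" "Cod C (s0 \<cdot> (q \<cdot> i)) = A"
    using tps i by simp_all
  note T = fibred_operation_of_morphism[OF P u]
  define J where "J = induced C p q (\<one> R) (\<Delta>S \<cdot> r1)"
  have J: "J \<in> Arr C" "Dom C J = R" "Cod C J = P" "p \<cdot> J = \<one> R" "q \<cdot> J = \<Delta>S \<cdot> r1"
    unfolding J_def using P_pair[of "\<one> R" "\<Delta>S \<cdot> r1"] tps \<Delta>S \<Delta>_extend by simp_all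
  define K where "K = induced C p q (\<Delta>R \<cdot> s0) (\<one> S)"
  have K: "K \<in> Arr C" "Dom C K = S" "Cod C K = P" "p \<cdot> K = \<Delta>R \<cdot> s0" "q \<cdot> K = \<one> S"
    unfolding K_def using P_pair[of "\<Delta>R \<cdot> s0" "\<one> S"] tps \<Delta>R \<Delta>_extend by simp_all
  note JK_ext = comp_eq_extend[OF J(4)] comp_eq_extend[OF J(5)] comp_eq_extend[OF K(4)] comp_eq_extend[OF K(5)]
  have J\<Delta>: "J \<cdot> \<Delta>R = induced C p q \<Delta>R \<Delta>S"
    by (rule induced_eqI[OF P, symmetric]) (use J \<Delta>R \<Delta>S \<Delta>_extend JK_ext tps in simp_all)
  have K\<Delta>: "K \<cdot> \<Delta>S = induced C p q \<Delta>R \<Delta>S"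
    by (rule induced_eqI[OF P, symmetric]) (use K \<Delta>R \<Delta>S \<Delta>_extend JK_ext tps in simp_all)
  have iJ: "i \<cdot> J = J \<cdot> induced C r0 r1 r1 r0"
    by (rule inverse_of_kernel_pair_morphism[OF ge R dom_f \<Delta>R])
      (use J J\<Delta> tps \<Delta>S \<Delta>_extend JK_ext in simp_all)
  have iK: "i \<cdot> K = K \<cdot> induced C s0 s1 s1 s0"
    by (rule inverse_of_kernel_pair_morphism[OF ge S dom_g \<Delta>S])
      (use K K\<Delta> tps \<Delta>R \<Delta>_extend JK_ext in simp_all)
  note \<sigma> = kernel_pair_symmetry[OF R] and \<sigma>' = kernel_pair_symmetry[OF S]
  show ?thesis
  proof (rule smith_commuteI[OF T _ _ _ _ _ _ _ _ _ _ _ _ _ _ _ _ _ _ _ _ P])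
    show "(s0 \<cdot> (q \<cdot> i)) \<cdot> induced C p q (\<one> R) (\<Delta>S \<cdot> r1) = r0"
      unfolding J_def[symmetric] using iJ tps i J \<sigma> \<Delta>S \<Delta>_extend JK_ext by simp
    show "(s0 \<cdot> (q \<cdot> i)) \<cdot> induced C p q (\<Delta>R \<cdot> s0) (\<one> S) = s1"
      unfolding K_def[symmetric] using iK tps i K \<sigma>' \<Delta>R \<Delta>_extend JK_ext by simp
  qed (use tps \<Delta>R \<Delta>S in simp_all)
qed

end

lemma (in pointed_protomodular_category) SH'_imp_SH:
  assumes SH': "condition_SH' C"
  shows "condition_SH C"
  unfolding condition_SH_def
proof (intro allI impI; elim conjE)
  fix A R r0 r1 \<Delta>R S s0 s1 \<Delta>S kerr0 kers0
  assume eR: "effective_equivalence_relation C A R r0 r1 \<Delta>R"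
    and eS: "effective_equivalence_relation C A S s0 s1 \<Delta>S"
    and kr: "is_kernel C r0 kerr0" and ks: "is_kernel C s0 kers0"
    and huq: "huq_commute C (r1 \<cdot> kerr0) (s1 \<cdot> kers0)"
  obtain f where f: "Dom C f = A" "is_pullback C f f R r0 r1"
    using eR unfolding effective_equivalence_relation_def by blast
  obtain g where g: "Dom C g = A" "is_pullback C g g S s0 s1"
    using eS unfolding effective_equivalence_relation_def by blast
  have \<Delta>: "\<Delta>R \<in> hom C A R" "r0 \<cdot> \<Delta>R = \<one> A" "r1 \<cdot> \<Delta>R = \<one> A"
    "\<Delta>S \<in> hom C A S" "s0 \<cdot> \<Delta>S = \<one> A" "s1 \<cdot> \<Delta>S = \<one> A"
    using eR eS unfolding effective_equivalence_relation_def equivalence_relation_def by blast+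
  interpret two_kernel_pairs C A R r0 r1 \<Delta>R S s0 s1 \<Delta>S f g
    by unfold_locales (use f g \<Delta> in \<open>simp_all add: mem_hom_iff\<close>)
  have "\<exists>P p q. is_pullback C r1 s0 P p q"
    using r_typing s_typing by (simp add: pullback_exists finitely_complete)
  then obtain P p q where P: "is_pullback C r1 s0 P p q" by blast
  interpret kernel_pair_triples C A R r0 r1 \<Delta>R S s0 s1 \<Delta>S f g P p q
    by unfold_locales (rule P)
  note tg = reflexive_graph_typing[OF triple_graph]
  obtain kd where kd: "is_kernel C (r0 \<cdot> p) kd" using kernel_exists tg(3) by blast
  obtain kc where kc: "is_kernel C (s1 \<cdot> q) kc" using kernel_exists tg(6) by blast
  have "huq_commute C kd kc"
    by (rule kernels_of_triple_graph_commute[OF normalisation_of_kernel_pair[OF R kr]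
      normalisation_of_kernel_pair[OF S ks] huq kd kc])
  then have "is_groupoid C P A (r0 \<cdot> p) (s1 \<cdot> q) (induced C p q \<Delta>R \<Delta>S)"
    using SH' triple_graph kd kc unfolding condition_SH'_def by blast
  then show "smith_commute C A R r0 r1 \<Delta>R S s0 s1 \<Delta>S" by (rule smith_commute_of_groupoid)
qed

theorem theorem1p6:
  fixes C :: "('o, 'm) category"
  assumes "pointed_protomodular_category C"
  shows "condition_SH C \<longleftrightarrow> condition_SH' C"
proof -
  interpret pointed_protomodular_category C by (rule assms)
  show ?thesis using SH_imp_SH' SH'_imp_SH by blast
qed

end
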